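(* Let $r\geq 2$, $t\geq 2$ with $t\mid n$, and $\alpha\in(0,1/2]$ with $\alpha n/t$ an integer. Let $c\geq 1$ and let $A\subseteq\mathbb{Z}_r^n$ with $|A|\geq r^n/2^c$, and let $X$ be uniformly distributed on $A$. For an $\alpha$-partial $t$-hypermatching $M$ (identified with its incidence matrix in $\{0,1\}^{\alpha n/t\times n}$) let $p_M$ be the distribution of $MX$ on $\mathbb{Z}_r^{\alpha n/t}$, i.e. $p_M(z)=|\{x\in A:Mx=z\}|/|A|$, and let $U$ be the uniform distribution on $\mathbb{Z}_r^{\alpha n/t}$. There is a universal constant $\gamma>0$ (independent of $n,t,r,\alpha$) such that for all $\varepsilon>0$, if $c\leq\frac{\gamma}{r}(\frac{\varepsilon^4}{\alpha})^{1/t}(n/t)^{1-1/t}$, then \[ \mathbb{E}_{M\sim\mathcal{M}^\alpha_{t,n}}\big[\|p_M-U\|_{\mathrm{tvd}}\big]\leq\varepsilon^2 . \]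
   Context: $\mathcal{M}^\alpha_{t,n}$ is the set of $\alpha$-partial $t$-hypermatchings on $[n]$ (sequences of $\alpha n/t$ pairwise disjoint hyperedges, each of $t$ distinct elements of $[n]$; row $i$ of the incidence matrix is the indicator of the $i$-th hyperedge), and $M\sim\mathcal{M}^\alpha_{t,n}$ is uniform. $Mx$ is computed over $\mathbb{Z}_r$. For distributions $P,Q$ on a finite set, $\|P-Q\|_{\mathrm{tvd}}=\sum_z|P(z)-Q(z)|$. *)

theory Defs
  imports "HOL-Probability.Probability" "Jordan_Normal_Form.Matrix"
begin

unbundle no vec_syntax

(* \<int>_r is represented by its residues 0, ..., r - 1, and the ground set [n] by {..<n}. *)

definition zvecs :: "nat \<Rightarrow> nat \<Rightarrow> int vec set" where
  "zvecs r n = {x \<in> carrier_vec n. \<forall>i<n. x $ i \<in> {0..<int r}}"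

(* The number of hyperedges is length M; the first conjunct says that it equals \<alpha> n / t. *)
definition hypermatchings :: "real \<Rightarrow> nat \<Rightarrow> nat \<Rightarrow> nat set list set" where
  "hypermatchings \<alpha> t n =
     {M. real (length M) = \<alpha> * real n / real t \<and>
         (\<forall>e\<in>set M. e \<subseteq> {..<n} \<and> card e = t) \<and>
         disjoint_family_on (\<lambda>i. M ! i) {..<length M}}"

definition incidence_mat :: "nat \<Rightarrow> nat set list \<Rightarrow> int mat" where
  "incidence_mat n M = mat (length M) n (\<lambda>(i, j). if j \<in> M ! i then 1 else 0)"

definition mult_mod :: "nat \<Rightarrow> int mat \<Rightarrow> int vec \<Rightarrow> int vec" where
  "mult_mod r B x = map_vec (\<lambda>a. a mod int r) (B *\<^sub>v x)"

definition image_dist :: "nat \<Rightarrow> nat \<Rightarrow> int vec set \<Rightarrow> nat set list \<Rightarrow> int vec pmf" where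
  "image_dist r n A M = map_pmf (mult_mod r (incidence_mat n M)) (pmf_of_set A)"

(* The full l1 distance, without the factor 1/2.  S is a finite set carrying both distributions. *)
definition tvd :: "'a set \<Rightarrow> 'a pmf \<Rightarrow> 'a pmf \<Rightarrow> real" where
  "tvd S P Q = (\<Sum>z\<in>S. \<bar>pmf P z - pmf Q z\<bar>)"

lemma pmf_image_dist:
  assumes "finite A" "A \<noteq> {}"
  shows "pmf (image_dist r n A M) z =
    real (card {x \<in> A. mult_mod r (incidence_mat n M) x = z}) / real (card A)"
proof -
  have "A \<inter> mult_mod r (incidence_mat n M) -` {z} =
      {x \<in> A. mult_mod r (incidence_mat n M) x = z}"
    by auto
  then show ?thesis
    using assms by (simp add: image_dist_def pmf_map measure_pmf_of_set)
qed

lemma bij_betw_zvecs: "bij_betw (vec n) ({..<n} \<rightarrow>\<^sub>E {0..<int r}) (zvecs r n)"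
proof (rule bij_betw_byWitness[where f' = "\<lambda>x. restrict (vec_index x) {..<n}"])
  show "\<forall>f\<in>{..<n} \<rightarrow>\<^sub>E {0..<int r}. restrict (vec_index (vec n f)) {..<n} = f"
  proof
    fix f assume f: "f \<in> {..<n} \<rightarrow>\<^sub>E {0..<int r}"
    show "restrict (vec_index (vec n f)) {..<n} = f"
    proof
      fix i show "restrict (vec_index (vec n f)) {..<n} i = f i"
        using PiE_arb[OF f, of i] by (cases "i < n") simp_all
    qed
  qed
  show "\<forall>x\<in>zvecs r n. vec n (restrict (vec_index x) {..<n}) = x"
    by (auto simp: zvecs_def)
  show "vec n ` ({..<n} \<rightarrow>\<^sub>E {0..<int r}) \<subseteq> zvecs r n"
    by (fastforce simp: zvecs_def PiE_iff)
  show "(\<lambda>x. restrict (vec_index x) {..<n}) ` zvecs r n \<subseteq> {..<n} \<rightarrow>\<^sub>E {0..<int r}"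
    unfolding zvecs_def by (intro image_subsetI restrict_PiE_iff[THEN iffD2]) simp
qed

lemma finite_zvecs: "finite (zvecs r n)"
proof -
  have "finite ({..<n} \<rightarrow>\<^sub>E {0..<int r})"
    by (intro finite_PiE) auto
  then show ?thesis
    using bij_betw_finite[OF bij_betw_zvecs] by blast
qed

lemma card_zvecs: "card (zvecs r n) = r ^ n"
  by (simp add: card_PiE flip: bij_betw_same_card[OF bij_betw_zvecs])

lemma mult_mod_in_zvecs:
  assumes "r > 0"
  shows "mult_mod r (incidence_mat n M) x \<in> zvecs r (length M)"
  unfolding zvecs_def mem_Collect_eq
proof (intro conjI allI impI)
  show *: "mult_mod r (incidence_mat n M) x \<in> carrier_vec (length M)"
    by (rule carrier_vecI) (simp add: mult_mod_def incidence_mat_def)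
  show "mult_mod r (incidence_mat n M) x $ i \<in> {0..<int r}" if "i < length M" for i
    using carrier_vecD[OF *] that assms unfolding mult_mod_def by simp
qed

lemma finite_hypermatchings: "finite (hypermatchings \<alpha> t n)"
proof (rule finite_subset)
  let ?k = "nat \<lfloor>\<alpha> * real n / real t\<rfloor>"
  show "hypermatchings \<alpha> t n \<subseteq> {M. set M \<subseteq> Pow {..<n} \<and> length M = ?k}"
  proof
    fix M assume M: "M \<in> hypermatchings \<alpha> t n"
    then have "\<alpha> * real n / real t = real (length M)"
      by (simp add: hypermatchings_def)
    then have "length M = ?k"
      by (simp only: floor_of_nat nat_int)
    with M show "M \<in> {M. set M \<subseteq> Pow {..<n} \<and> length M = ?k}"
      by (auto simp: hypermatchings_def)
  qed
qed (simp add: finite_lists_length_eq)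

lemma hypermatchings_nonempty:
  assumes "real m = \<alpha> * real n / real t" "\<alpha> \<le> 1" "t > 0"
  shows "hypermatchings \<alpha> t n \<noteq> {}"
proof -
  define M where "M = map (\<lambda>i. {i * t..<Suc i * t}) [0..<m]"
  have "real (m * t) = \<alpha> * real n"
    using assms by (simp add: field_simps)
  also have "\<dots> \<le> 1 * real n"
    using assms(2) by (intro mult_right_mono) simp_all
  finally have mt: "m * t \<le> n"
    by (simp only: mult_1 of_nat_le_iff)
  have sub: "{i * t..<Suc i * t} \<subseteq> {..<n}" if "i < m" for i
  proof -
    have "Suc i * t \<le> m * t"
      using that by (intro mult_le_mono1) simp
    then show ?thesis
      using mt by auto
  qed
  have disj: "{i * t..<Suc i * t} \<inter> {j * t..<Suc j * t} = {}" if "i < j" for i j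
  proof -
    have "Suc i * t \<le> j * t"
      using that by (intro mult_le_mono1) simp
    then show ?thesis
      by auto
  qed
  have nth: "M ! i = {i * t..<Suc i * t}" if "i < m" for i
    using that by (simp only: M_def nth_map length_upt nth_upt add_0 diff_zero)
  have len: "length M = m"
    by (simp add: M_def)
  have "disjoint_family_on (\<lambda>i. M ! i) {..<length M}"
    unfolding disjoint_family_on_def
  proof (intro ballI impI)
    fix i j assume "i \<in> {..<length M}" "j \<in> {..<length M}" "i \<noteq> j"
    then have *: "i < m" "j < m" "i < j \<or> j < i"
      by (auto simp: len)
    show "M ! i \<inter> M ! j = {}"
      unfolding nth[OF *(1)] nth[OF *(2)] using *(3) disj[of i j] disj[of j i] by blast
  qed
  moreover have "\<forall>e\<in>set M. e \<subseteq> {..<n} \<and> card e = t"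
  proof
    fix e assume "e \<in> set M"
    then obtain i where i: "i < m" "e = {i * t..<Suc i * t}"
      unfolding M_def set_map set_upt by force
    have "card e = t"
      by (simp add: i(2))
    with sub[OF i(1)] i(2) show "e \<subseteq> {..<n} \<and> card e = t"
      by blast
  qed
  ultimately have "M \<in> hypermatchings \<alpha> t n"
    using assms(1) by (simp add: hypermatchings_def len)
  then show ?thesis
    by blast
qed

end

(* Write F(S) = sum over x in A of the character S at x.  By Parseval and Cauchy-Schwarz, the square of
   |p_M - U| is at most the sum over V \<noteq> 0 of |F(M^T V)|^2 / |A|^2.  The vector M^T V is supported on
   a union of hyperedges of M, and a fixed set of size t k is such a union with probability at most
   (m choose k) / (n choose t k).  The level inequality, i.e. hypercontractivity on Z_r^n applied to the
   indicator of A with exponent p = 1 + k / c, bounds the Fourier weight of A on level t k by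
   (2 r c / k)^(t k) for k \<le> c; for k > c, Parseval gives the bound 2^c, and there the probabilities
   halve whenever k grows by one, so everything is dominated by a geometric series. *)
theory Submission
  imports Defs
begin

text \<open>Nonnegativity stands in for a sharp hypercontractive inequality. A nonnegative function
  of mean 1 on r points is bounded by r, so on its range v^p dominates a parabola that touches it at
  1 and has 1/r times its curvature there. This elementary bound yields \<delta> = (p - 1) / r, and
  that r is the 1/r in front of the bound on c. The noise operator never appears as an operator: its
  squared norm is a quadratic form whose kernel is a product over coordinates of 1 - \<delta> +
  \<delta> r [x_i = y_i], which is entrywise nonnegative and becomes the weight \<delta>^|supp S| on
  the Fourier side. The shape of the hypothesis is the term k = 1 solved for c: m (2 r c t / n)^t
  equals \<alpha> (2 r c)^t (n / t)^(1 - t), and \<gamma> = 1/8 makes this at most \<epsilon>^4 / 16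
  for every t >= 2. The fourth power is there because the second moment over M is bounded by
  \<epsilon>^4, and passing to the mean takes a square root.\<close>

section \<open>Hypercontractivity in one coordinate\<close>

text \<open>Subtracting the linear and quadratic terms from v^p leaves a function \<open>g\<close>
  that is convex on (0, R], since x^(p - 2) >= 1/R there, and has slope 0 at 1; so \<open>g\<close>
  is at least \<open>g 1\<close> = 1. The point 0 is treated apart because the derivative formulas
  are for a positive base.\<close>

lemma powr_ge_quadratic:
  fixes v p R :: real
  assumes p: "1 \<le> p" "p \<le> 2" and R: "2 \<le> R" and v: "0 \<le> v" "v \<le> R"
  shows "1 + p * (v - 1) + p * (p - 1) / (2 * R) * (v - 1)\<^sup>2 \<le> v powr p"
proof (cases "v = 0")
  case True
  have "p * (p - 1) \<le> 2 * (p - 1)"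
    using p by (intro mult_right_mono) auto
  also have "\<dots> \<le> (2 * R) * (p - 1)"
    using p R by (intro mult_right_mono) auto
  finally have "p * (p - 1) / (2 * R) \<le> p - 1"
    using R by (simp add: field_simps)
  with True p show ?thesis
    by simp
next
  case False
  define g where "g v = v powr p - p * (v - 1) - p * (p - 1) / (2 * R) * (v - 1)\<^sup>2" for v
  define g' where "g' v = p * v powr (p - 1) - p - p * (p - 1) / R * (v - 1)" for v
  define g'' where "g'' v = p * ((p - 1) * v powr (p - 2)) - p * (p - 1) / R" for v
  have g: "DERIV g x :> g' x" if "0 < x" for x
    unfolding g_def g'_def using that R
    by (auto intro!: derivative_eq_intros simp: field_simps)
  have g': "DERIV g' x :> g'' x" if "0 < x" for x
    unfolding g'_def g''_def using that R
    by (auto intro!: derivative_eq_intros simp: field_simps)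
  have g'': "0 \<le> g'' x" if x: "0 < x" "x \<le> R" for x
  proof -
    have "1 / R \<le> x powr (p - 2)"
    \<comment> \<open>Up to 1 the exponent p - 2 <= 0 already gives at least 1; beyond 1, p - 2 >=
      -1 gives at least 1/x.\<close>
    proof (cases "x \<le> 1")
      case True
      then have "1 \<le> x powr (p - 2)"
        using x p powr_mono'[of "p - 2" 0 x] by simp
      moreover have "1 / R \<le> 1" using R by simp
      ultimately show ?thesis by linarith
    next
      case False
      have "1 / R \<le> 1 / x"
        using x by (intro divide_left_mono) auto
      also have "\<dots> = x powr (- 1)"
        using x by (simp add: powr_minus_divide)
      also have "\<dots> \<le> x powr (p - 2)"
        using False p by (intro powr_mono) auto
      finally show ?thesis .
    qed
    then have "p * (p - 1) * (1 / R) \<le> p * (p - 1) * x powr (p - 2)"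
      using p by (intro mult_left_mono) auto
    then show ?thesis
      by (simp add: g''_def)
  qed
  have "convex_on {0<..R} g"
    by (rule f''_ge0_imp_convex[where f' = g' and f'' = g''])
      (use g g' g'' in \<open>auto\<close>)
  moreover have "1 \<in> interior {0<..R}"
    using R by (intro interiorI[of "{0<..<R}"]) auto
  moreover have "(g has_field_derivative g' 1) (at 1 within {0<..R})"
    using g[of 1] by (simp add: has_field_derivative_at_within)
  ultimately have "g v - g 1 \<ge> g' 1 * (v - 1)"
    using v False by (intro convex_on_imp_above_tangent[where A = "{0<..R}"]) auto
  then show ?thesis
    by (simp add: g_def g'_def)
qed

text \<open>Weighted AM-GM for 1 + s x and 1 with weights 1/s and 1 - 1/s, raised to the power
  s.\<close>

lemma Bernoulli_powr:
  fixes x s :: real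
  assumes "0 \<le> x" "1 \<le> s"
  shows "1 + s * x \<le> (1 + x) powr s"
proof -
  have "(1 + s * x) powr (1 / s) * 1 powr (1 - 1 / s) \<le> 1 / s * (1 + s * x) + (1 - 1 / s) * 1"
    using assms by (intro Youngs_inequality_0) (auto simp: add_pos_nonneg)
  also have "\<dots> = 1 + x"
    using assms by (simp add: field_simps)
  finally have "(1 + s * x) powr (1 / s) \<le> 1 + x"
    by simp
  then have "((1 + s * x) powr (1 / s)) powr s \<le> (1 + x) powr s"
    using assms by (intro powr_mono2) auto
  then show ?thesis
    using assms by (simp add: powr_powr add_nonneg_nonneg)
qed

text \<open>Divided by r^2 and read in uniform measure, this is (E u)^2 + \<delta> Var u <= (E
  u^p)^(2/p). By homogeneity the mean may be taken to be 1; the values are then at most r, and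
  averaging \<open>powr_ge_quadratic\<close> with R = r kills the linear term and leaves the
  variance \<open>w\<close>.\<close>

lemma one_point_hypercontractivity:
  fixes u :: "'a \<Rightarrow> real" and p :: real
  assumes Z: "finite Z" "card Z = r" "2 \<le> r" and u: "\<And>a. a \<in> Z \<Longrightarrow> 0 \<le> u a"
    and p: "1 < p" "p \<le> 2" and \<delta>: "\<delta> = (p - 1) / real r"
  shows "(1 - \<delta>) * (\<Sum>a\<in>Z. u a)\<^sup>2 + \<delta> * real r * (\<Sum>a\<in>Z. (u a)\<^sup>2)
    \<le> real r powr (2 - 2 / p) * (\<Sum>a\<in>Z. u a powr p) powr (2 / p)"
proof (cases "(\<Sum>a\<in>Z. u a) = 0")
  case True
  then have "\<forall>a\<in>Z. u a = 0"
    using Z u by (simp add: sum_nonneg_eq_0_iff)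
  then show ?thesis
    by simp
next
  case False
  define s where "s = (\<Sum>a\<in>Z. u a) / real r"
  have r: "real r \<ge> 2" using Z by simp
  have s: "s > 0"
    using False sum_nonneg[of Z u] u r by (simp add: s_def)
  define v where "v a = u a / s" for a
  have v0: "0 \<le> v a" if "a \<in> Z" for a
    using u[OF that] s by (simp add: v_def)
  have vsum: "(\<Sum>a\<in>Z. v a) = real r"
  proof -
    have "(\<Sum>a\<in>Z. v a) = (\<Sum>a\<in>Z. u a) / s"
      by (simp add: v_def sum_divide_distrib)
    then show ?thesis
      using False r by (simp add: s_def)
  qed
  have vr: "v a \<le> real r" if "a \<in> Z" for a
    using member_le_sum[of a Z v] that v0 Z vsum by auto
  define w where "w = (\<Sum>a\<in>Z. (v a - 1)\<^sup>2) / real r"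
  have w0: "0 \<le> w"
    by (simp add: w_def sum_nonneg)
  have w: "(\<Sum>a\<in>Z. (v a)\<^sup>2) = real r * (1 + w)"
  proof -
    have "real r * w = (\<Sum>a\<in>Z. (v a)\<^sup>2 - 2 * v a + 1)"
      using r by (simp add: w_def power2_diff algebra_simps)
    also have "\<dots> = (\<Sum>a\<in>Z. (v a)\<^sup>2) - real r"
      using vsum Z by (simp add: sum.distrib sum_subtractf flip: sum_distrib_left)
    finally show ?thesis by (simp add: algebra_simps)
  qed
  have "real r * (1 + p / 2 * (\<delta> * w)) =
      (\<Sum>a\<in>Z. 1 + p * (v a - 1) + p * (p - 1) / (2 * real r) * (v a - 1)\<^sup>2)"
  proof -
    have "(\<Sum>a\<in>Z. 1 + p * (v a - 1) + p * (p - 1) / (2 * real r) * (v a - 1)\<^sup>2) =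
        real r + p * (\<Sum>a\<in>Z. v a - 1) + p * (p - 1) / (2 * real r) * (\<Sum>a\<in>Z. (v a - 1)\<^sup>2)"
      using Z by (simp add: sum.distrib sum_distrib_left)
    moreover have "(\<Sum>a\<in>Z. v a - 1) = 0"
      using vsum Z by (simp add: sum_subtractf)
    moreover have "(\<Sum>a\<in>Z. (v a - 1)\<^sup>2) = real r * w"
      using r by (simp add: w_def)
    ultimately show ?thesis
      using r by (simp add: \<delta> field_simps)
  qed
  also have "\<dots> \<le> (\<Sum>a\<in>Z. v a powr p)"
    using v0 vr p r by (intro sum_mono powr_ge_quadratic) auto
  finally have *: "real r * (1 + p / 2 * (\<delta> * w)) \<le> (\<Sum>a\<in>Z. v a powr p)" .
  have \<delta>0: "0 \<le> \<delta>" using p r by (simp add: \<delta>)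
  \<comment> \<open>Bernoulli with exponent 2/p >= 1 absorbs the factor p/2 that the parabola leaves
    in front of \<delta> w.\<close>
  have "1 + \<delta> * w = 1 + 2 / p * (p / 2 * (\<delta> * w))"
    using p by simp
  also have "\<dots> \<le> (1 + p / 2 * (\<delta> * w)) powr (2 / p)"
    using p \<delta>0 w0 by (intro Bernoulli_powr) auto
  finally have "(real r)\<^sup>2 * (1 + \<delta> * w) \<le> (real r)\<^sup>2 * (1 + p / 2 * (\<delta> * w)) powr (2 / p)"
    by (intro mult_left_mono) auto
  also have "(real r)\<^sup>2 = real r powr (2 - 2 / p) * real r powr (2 / p)"
    using r by (simp flip: powr_add)
  also have "real r powr (2 - 2 / p) * real r powr (2 / p) * (1 + p / 2 * (\<delta> * w)) powr (2 / p)
      = real r powr (2 - 2 / p) * (real r * (1 + p / 2 * (\<delta> * w))) powr (2 / p)"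
    using r p \<delta>0 w0 by (simp add: powr_mult)
  also have "\<dots> \<le> real r powr (2 - 2 / p) * (\<Sum>a\<in>Z. v a powr p) powr (2 / p)"
    using * p r \<delta>0 w0 by (intro mult_left_mono powr_mono2) auto
  finally have **: "(real r)\<^sup>2 * (1 + \<delta> * w) \<le> real r powr (2 - 2 / p) * (\<Sum>a\<in>Z. v a powr p) powr (2 / p)"
    using r by (simp flip: powr_add)
  have us: "u a = s * v a" for a
    using s by (simp add: v_def)
  have "(1 - \<delta>) * (\<Sum>a\<in>Z. u a)\<^sup>2 + \<delta> * real r * (\<Sum>a\<in>Z. (u a)\<^sup>2) = s\<^sup>2 * ((real r)\<^sup>2 * (1 + \<delta> * w))"
    by (simp add: us power_mult_distrib vsum w flip: sum_distrib_left)
      (simp add: algebra_simps power2_eq_square)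
  also have "\<dots> \<le> s\<^sup>2 * (real r powr (2 - 2 / p) * (\<Sum>a\<in>Z. v a powr p) powr (2 / p))"
    using ** by (intro mult_left_mono) auto
  also have "s\<^sup>2 = (s powr p) powr (2 / p)"
    using s p by (simp add: powr_powr)
  also have "(s powr p) powr (2 / p) * (real r powr (2 - 2 / p) * (\<Sum>a\<in>Z. v a powr p) powr (2 / p))
      = real r powr (2 - 2 / p) * (\<Sum>a\<in>Z. u a powr p) powr (2 / p)"
  proof -
    have "(\<Sum>a\<in>Z. u a powr p) = s powr p * (\<Sum>a\<in>Z. v a powr p)"
      using s v0 by (simp add: us powr_mult sum_distrib_left)
    then show ?thesis
      by (simp add: powr_mult sum_nonneg)
  qed
  finally show ?thesis .
qed

text \<open>Cauchy-Schwarz for the form \<open>B\<close>, which is positive semidefinite because 0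
  <= \<delta> <= 1. The diagonal inequality is applied only to the nonnegative \<open>u\<close> and
  \<open>v\<close>; for the signed combination \<open>d\<close> the proof uses just that
  \<open>B d d\<close> is nonnegative.\<close>

lemma one_point_hypercontractivity_bilinear:
  fixes u v :: "'a \<Rightarrow> real" and p :: real
  assumes Z: "finite Z" "card Z = r" "2 \<le> r"
    and u: "\<And>a. a \<in> Z \<Longrightarrow> 0 \<le> u a" and v: "\<And>a. a \<in> Z \<Longrightarrow> 0 \<le> v a"
    and p: "1 < p" "p \<le> 2" and \<delta>: "\<delta> = (p - 1) / real r"
  shows "(1 - \<delta>) * ((\<Sum>a\<in>Z. u a) * (\<Sum>a\<in>Z. v a)) + \<delta> * real r * (\<Sum>a\<in>Z. u a * v a)
    \<le> real r powr (2 - 2 / p) * (\<Sum>a\<in>Z. u a powr p) powr (1 / p) * (\<Sum>a\<in>Z. v a powr p) powr (1 / p)"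
proof -
  define N where "N u = (\<Sum>a\<in>Z. u a powr p) powr (1 / p)" for u :: "'a \<Rightarrow> real"
  define B where "B u v = (1 - \<delta>) * ((\<Sum>a\<in>Z. u a) * (\<Sum>a\<in>Z. v a)) + \<delta> * real r * (\<Sum>a\<in>Z. u a * v a)"
    for u v :: "'a \<Rightarrow> real"
  have \<delta>01: "0 \<le> \<delta>" "\<delta> \<le> 1"
    using p Z by (auto simp: \<delta> field_simps)
  have N2: "N u ^ 2 = (\<Sum>a\<in>Z. u a powr p) powr (2 / p)" for u
    unfolding N_def by (simp add: powr_powr flip: powr_numeral)
  have diag: "B w w \<le> real r powr (2 - 2 / p) * N w ^ 2" if "\<And>a. a \<in> Z \<Longrightarrow> 0 \<le> w a" for w
    using one_point_hypercontractivity[OF Z that p \<delta>] unfolding N2 B_def by (simp add: power2_eq_square)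
  have N0: "w a = 0" if "N w = 0" "a \<in> Z" "\<And>a. a \<in> Z \<Longrightarrow> 0 \<le> w a" for w a
    using that Z p by (simp add: N_def sum_nonneg_eq_0_iff)
  have Nnn: "0 \<le> N w" for w by (simp add: N_def)
  have "B u v \<le> real r powr (2 - 2 / p) * N u * N v"
  proof (cases "N u = 0 \<or> N v = 0")
    case True
    then have "(\<forall>a\<in>Z. u a = 0) \<or> (\<forall>a\<in>Z. v a = 0)"
      using N0[of u] N0[of v] u v by blast
    then have "B u v = 0"
      by (auto simp: B_def)
    then show ?thesis
      using Nnn[of u] Nnn[of v] by (simp add: mult_nonneg_nonneg)
  next
    case False
    then have pos: "N u > 0" "N v > 0"
      using Nnn[of u] Nnn[of v] by auto
    \<comment> \<open>With these coefficients both diagonal terms receive the same bound, so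
      dividing by 2 \<open>N u\<close> \<open>N v\<close> gives the claim.\<close>
    define d where "d a = N v * u a - N u * v a" for a
    have "B d d = (1 - \<delta>) * (\<Sum>a\<in>Z. d a)\<^sup>2 + \<delta> * real r * (\<Sum>a\<in>Z. (d a)\<^sup>2)"
      by (simp add: B_def power2_eq_square)
    then have "0 \<le> B d d"
      using \<delta>01 by (simp add: sum_nonneg)
    also have "B d d = N v ^ 2 * B u u + N u ^ 2 * B v v - 2 * N u * N v * B u v"
    proof -
      have "(\<Sum>a\<in>Z. d a) = N v * (\<Sum>a\<in>Z. u a) - N u * (\<Sum>a\<in>Z. v a)"
        by (simp add: d_def sum_subtractf sum_distrib_left)
      moreover have "(\<Sum>a\<in>Z. d a * d a) = N v ^ 2 * (\<Sum>a\<in>Z. u a * u a)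
          + N u ^ 2 * (\<Sum>a\<in>Z. v a * v a) - 2 * N u * N v * (\<Sum>a\<in>Z. u a * v a)"
        by (simp add: d_def sum_subtractf sum.distrib sum_distrib_left algebra_simps power2_eq_square)
      ultimately show ?thesis
        unfolding B_def by (simp only:) (simp add: algebra_simps power2_eq_square)
    qed
    finally have "2 * N u * N v * B u v \<le> N v ^ 2 * B u u + N u ^ 2 * B v v"
      by simp
    also have "\<dots> \<le> N v ^ 2 * (real r powr (2 - 2 / p) * N u ^ 2)
        + N u ^ 2 * (real r powr (2 - 2 / p) * N v ^ 2)"
      by (intro add_mono mult_left_mono diag u v) auto
    also have "\<dots> = 2 * N u * N v * (real r powr (2 - 2 / p) * N u * N v)"
      by (simp add: power2_eq_square)
    finally show ?thesis
      using pos by (simp add: mult_le_cancel_left)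
  qed
  then show ?thesis
    by (simp add: B_def N_def)
qed

section \<open>Tensorisation over the coordinates\<close>

lemma sum_PiE_lessThan_Suc:
  "(\<Sum>x\<in>{..<Suc n} \<rightarrow>\<^sub>E Z. f x) = (\<Sum>a\<in>Z. \<Sum>x\<in>{..<n} \<rightarrow>\<^sub>E Z. f (x(n := a)))"
proof -
  have "(\<Sum>x\<in>{..<Suc n} \<rightarrow>\<^sub>E Z. f x) = (\<Sum>(a, x)\<in>Z \<times> ({..<n} \<rightarrow>\<^sub>E Z). f (x(n := a)))"
    unfolding lessThan_Suc PiE_insert_eq
    by (subst sum.reindex[OF inj_combinator]) (auto intro!: sum.cong)
  then show ?thesis
    by (simp add: sum.cartesian_product)
qed

text \<open>Stated bilinearly so that the induction on \<^term>\<open>n\<close> needs Cauchy-Schwarz only on a single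
  coordinate; the exponent of \<^term>\<open>r\<close> compensates for using counting instead of uniform measure.\<close>
lemma hypercontractivity_bilinear:
  fixes g h :: "(nat \<Rightarrow> 'a) \<Rightarrow> real" and p :: real
  assumes Z: "finite Z" "card Z = r" "2 \<le> r"
    and p: "1 < p" "p \<le> 2" and \<delta>: "\<delta> = (p - 1) / real r"
    and "\<And>x. x \<in> {..<n} \<rightarrow>\<^sub>E Z \<Longrightarrow> 0 \<le> g x" "\<And>x. x \<in> {..<n} \<rightarrow>\<^sub>E Z \<Longrightarrow> 0 \<le> h x"
  shows "(\<Sum>x\<in>{..<n} \<rightarrow>\<^sub>E Z. \<Sum>y\<in>{..<n} \<rightarrow>\<^sub>E Z.
      g x * h y * (\<Prod>i<n. 1 - \<delta> + \<delta> * real r * of_bool (x i = y i)))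
    \<le> (real r powr (2 - 2 / p)) ^ n * (\<Sum>x\<in>{..<n} \<rightarrow>\<^sub>E Z. g x powr p) powr (1 / p)
        * (\<Sum>x\<in>{..<n} \<rightarrow>\<^sub>E Z. h x powr p) powr (1 / p)"
  using assms(7,8)
proof (induction n arbitrary: g h)
  case 0
  then show ?case
    using p by (simp add: powr_powr)
next
  case (Suc n)
  define K where "K a b = 1 - \<delta> + \<delta> * real r * of_bool (a = b)" for a b :: 'a
  define C where "C = real r powr (2 - 2 / p)"
  define P where "P = {..<n} \<rightarrow>\<^sub>E Z"
  define N where "N g = (\<Sum>x\<in>P. g x powr p) powr (1 / p)" for g
  define u where "u a = N (\<lambda>x. g (x(n := a)))" for a
  define v where "v a = N (\<lambda>x. h (x(n := a)))" for a
  have \<delta>01: "0 \<le> \<delta>" "\<delta> \<le> 1"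
    using p Z by (auto simp: \<delta> field_simps)
  have C0: "0 \<le> C" by (simp add: C_def)
  have upd: "x(n := a) \<in> {..<Suc n} \<rightarrow>\<^sub>E Z" if "x \<in> P" "a \<in> Z" for x a
    using that unfolding P_def lessThan_Suc by (rule PiE_fun_upd[rotated])
  have [simp]: "(\<Prod>i<n. K (if i = n then a else x i) (if i = n then b else y i)) = (\<Prod>i<n. K (x i) (y i))"
    for a b x y by (intro prod.cong) auto
  have "(\<Sum>x\<in>{..<Suc n} \<rightarrow>\<^sub>E Z. \<Sum>y\<in>{..<Suc n} \<rightarrow>\<^sub>E Z. g x * h y * (\<Prod>i<Suc n. K (x i) (y i)))
      = (\<Sum>a\<in>Z. \<Sum>x\<in>P. \<Sum>b\<in>Z. \<Sum>y\<in>P.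
          K a b * (g (x(n := a)) * h (y(n := b)) * (\<Prod>i<n. K (x i) (y i))))"
    unfolding sum_PiE_lessThan_Suc P_def by (simp add: mult_ac)
  also have "\<dots> = (\<Sum>a\<in>Z. \<Sum>b\<in>Z. K a b *
      (\<Sum>x\<in>P. \<Sum>y\<in>P. g (x(n := a)) * h (y(n := b)) * (\<Prod>i<n. K (x i) (y i))))"
    unfolding sum_distrib_left by (intro sum.cong sum.swap refl)
  \<comment> \<open>The induction hypothesis is used for the slice of \<open>g\<close> at
    \<open>a\<close> and the slice of \<open>h\<close> at \<open>b\<close>, in general two different
    functions; \<open>K a b\<close> >= 0 preserves the inequality.\<close>
  also have "\<dots> \<le> (\<Sum>a\<in>Z. \<Sum>b\<in>Z. K a b * (C ^ n * u a * v b))"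
  proof (intro sum_mono mult_left_mono)
    fix a b assume ab: "a \<in> Z" "b \<in> Z"
    show "(\<Sum>x\<in>P. \<Sum>y\<in>P. g (x(n := a)) * h (y(n := b)) * (\<Prod>i<n. K (x i) (y i))) \<le> C ^ n * u a * v b"
      unfolding u_def v_def C_def N_def K_def P_def
      by (rule Suc.IH) (use Suc.prems upd ab in \<open>auto simp: P_def fun_upd_def\<close>)
    show "0 \<le> K a b"
      using \<delta>01 by (simp add: K_def)
  qed
  also have "\<dots> = C ^ n * ((1 - \<delta>) * ((\<Sum>a\<in>Z. u a) * (\<Sum>a\<in>Z. v a)) + \<delta> * real r * (\<Sum>a\<in>Z. u a * v a))"
  proof -
    have "(\<Sum>b\<in>Z. K a b * (C ^ n * u a * v b)) =
        C ^ n * ((1 - \<delta>) * (u a * (\<Sum>b\<in>Z. v b)) + \<delta> * real r * (u a * v a))" if "a \<in> Z" for a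
    proof -
      have "(\<Sum>b\<in>Z. K a b * (C ^ n * u a * v b)) =
         (\<Sum>b\<in>Z. C ^ n * (1 - \<delta>) * u a * v b + (if a = b then C ^ n * \<delta> * real r * u a * v b else 0))"
        by (intro sum.cong refl) (simp add: K_def algebra_simps)
      also have "\<dots> = C ^ n * (1 - \<delta>) * u a * (\<Sum>b\<in>Z. v b) + C ^ n * \<delta> * real r * u a * v a"
        using that Z by (simp add: sum.distrib sum_distrib_left)
      finally show ?thesis by (simp add: algebra_simps)
    qed
    then have "(\<Sum>a\<in>Z. \<Sum>b\<in>Z. K a b * (C ^ n * u a * v b)) =
        (\<Sum>a\<in>Z. C ^ n * ((1 - \<delta>) * (u a * (\<Sum>b\<in>Z. v b)) + \<delta> * real r * (u a * v a)))"
      by (intro sum.cong) auto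
    then show ?thesis
      by (simp add: sum.distrib flip: sum_distrib_left sum_distrib_right)
  qed
  also have "\<dots> \<le> C ^ n * (C * (\<Sum>a\<in>Z. u a powr p) powr (1 / p) * (\<Sum>a\<in>Z. v a powr p) powr (1 / p))"
    unfolding C_def by (intro mult_left_mono one_point_hypercontractivity_bilinear[OF Z _ _ p \<delta>])
      (auto simp: u_def v_def N_def)
  \<comment> \<open>\<open>u a\<close> is a p-th root over the slice at \<open>a\<close>, so its
    p-th powers add up to the sum over all n + 1 coordinates.\<close>
  also have "(\<Sum>a\<in>Z. u a powr p) = (\<Sum>x\<in>{..<Suc n} \<rightarrow>\<^sub>E Z. g x powr p)"
    unfolding sum_PiE_lessThan_Suc u_def N_def P_def using p by (simp add: powr_powr sum_nonneg)
  also have "(\<Sum>a\<in>Z. v a powr p) = (\<Sum>x\<in>{..<Suc n} \<rightarrow>\<^sub>E Z. h x powr p)"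
    unfolding sum_PiE_lessThan_Suc v_def N_def P_def using p by (simp add: powr_powr sum_nonneg)
  finally show ?case
    unfolding C_def K_def by (simp add: mult_ac)
qed

section \<open>Characters and Fourier transform on Z_r^n\<close>

definition zchar :: "nat \<Rightarrow> int \<Rightarrow> complex" where
  "zchar r a = cis (2 * pi * real_of_int a / real r)"

lemma zchar_0 [simp]: "zchar r 0 = 1"
  by (simp add: zchar_def)

lemma zchar_add: "zchar r (a + b) = zchar r a * zchar r b"
  by (simp add: zchar_def cis_mult ring_distribs add_divide_distrib)

lemma zchar_sum: "zchar r (\<Sum>i\<in>I. f i) = (\<Prod>i\<in>I. zchar r (f i))"
  by (induction I rule: infinite_finite_induct) (auto simp: zchar_add)

lemma cnj_zchar: "cnj (zchar r a) = zchar r (- a)"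
  by (simp add: zchar_def cis_cnj)

lemma zchar_multiple:
  assumes "r > 0"
  shows "zchar r (int r * a) = 1"
proof -
  have "2 * pi * real_of_int (int r * a) / real r = 2 * pi * real_of_int a"
    using assms by simp
  then show ?thesis
    unfolding zchar_def by (simp only: cis_multiple_2pi Ints_of_int)
qed

lemma zchar_mult_mod:
  assumes "r > 0"
  shows "zchar r (b * (a mod int r)) = zchar r (b * a)"
proof -
  have "b * a = b * (a mod int r) + int r * (b * (a div int r))"
    by (metis mod_mult_div_eq distrib_left mult.left_commute)
  then show ?thesis
    using assms by (simp only: zchar_add zchar_multiple) simp
qed

lemma zchar_eq_1_iff:
  assumes "r > 0"
  shows "zchar r a = 1 \<longleftrightarrow> int r dvd a"
proof
  assume "zchar r a = 1"
  then have "cos (2 * pi * real_of_int a / real r) = 1"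
    by (simp add: zchar_def complex_eq_iff)
  then obtain k :: int where "2 * pi * real_of_int a / real r = of_int k * 2 * pi"
    using cos_one_2pi_int by metis
  then have "real_of_int a = real_of_int (k * int r)"
    using assms by (simp add: field_simps)
  then show "int r dvd a"
    by (simp only: of_int_eq_iff) simp
qed (use assms zchar_multiple in \<open>auto elim!: dvdE\<close>)

lemma sum_zchar:
  assumes "r > 0"
  shows "(\<Sum>s\<in>{0..<int r}. zchar r (s * a)) = (if int r dvd a then of_nat r else 0)"
proof -
  have pow: "zchar r (int k * a) = zchar r a ^ k" for k
    by (induction k) (auto simp: zchar_add ring_distribs)
  have "(\<Sum>s\<in>{0..<int r}. zchar r (s * a)) = (\<Sum>k<r. zchar r a ^ k)"
    by (rule sum.reindex_bij_witness[where i = int and j = nat]) (auto simp flip: pow)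
  moreover have "zchar r a ^ r = 1"
    using assms zchar_multiple[of r a] by (simp flip: pow)
  moreover have "(\<Sum>k<r. zchar r a ^ k) = (if zchar r a = 1 then of_nat r else (zchar r a ^ r - 1) / (zchar r a - 1))"
    by (simp add: geometric_sum)
  ultimately show ?thesis
    using assms by (simp add: zchar_eq_1_iff)
qed

text \<open>Unnormalised, so a probability vector has coefficient 1 at frequency 0. Points and
  frequencies are extensional functions, which lets a product of coordinate sums expand by
  \<open>prod_sum_PiE\<close>.\<close>

definition dft :: "nat \<Rightarrow> nat \<Rightarrow> ((nat \<Rightarrow> int) \<Rightarrow> real) \<Rightarrow> (nat \<Rightarrow> int) \<Rightarrow> complex" where
  "dft r n h S = (\<Sum>x\<in>{..<n} \<rightarrow>\<^sub>E {0..<int r}. of_real (h x) * (\<Prod>i<n. zchar r (S i * x i)))"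

text \<open>The weight is a product over coordinates, so the kernel obtained by summing over S
  factors as well; in one coordinate, orthogonality of characters gives 1 - \<delta> + \<delta> r
  [a = b]. This is the kernel of \<open>hypercontractivity_bilinear\<close>, and \<delta> = 1 gives
  Parseval.\<close>

lemma dft_energy:
  assumes r: "r > 0"
  shows "(\<Sum>S\<in>{..<n} \<rightarrow>\<^sub>E {0..<int r}. (\<Prod>i<n. if S i = 0 then 1 else \<delta>) * (cmod (dft r n h S))\<^sup>2)
    = (\<Sum>x\<in>{..<n} \<rightarrow>\<^sub>E {0..<int r}. \<Sum>y\<in>{..<n} \<rightarrow>\<^sub>E {0..<int r}.
        h x * h y * (\<Prod>i<n. 1 - \<delta> + \<delta> * real r * of_bool (x i = y i)))"
    (is "?L = ?R")
proof -
  define Z where "Z = {0..<int r}"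
  define P where "P = {..<n} \<rightarrow>\<^sub>E Z"
  define w where "w s = (if s = 0 then 1 else \<delta>)" for s :: int
  have K: "(\<Sum>s\<in>Z. of_real (w s) * zchar r (s * (a - b)))
      = complex_of_real (1 - \<delta> + \<delta> * real r * of_bool (a = b))" if "a \<in> Z" "b \<in> Z" for a b
  proof -
    have "(\<Sum>s\<in>Z. of_real (w s) * zchar r (s * (a - b))) =
        (\<Sum>s\<in>Z. of_real \<delta> * zchar r (s * (a - b)) + (if s = 0 then of_real (1 - \<delta>) else 0))"
      by (intro sum.cong) (auto simp: w_def)
    also have "\<dots> = of_real \<delta> * (if int r dvd a - b then of_nat r else 0) + of_real (1 - \<delta>)"
      using r by (simp add: sum.distrib Z_def sum_zchar flip: sum_distrib_left)
    also have "int r dvd a - b \<longleftrightarrow> a = b"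
      using that by (auto simp: Z_def mod_eq_dvd_iff[symmetric])
    finally show ?thesis by simp
  qed
  have sq: "complex_of_real ((cmod (dft r n h S))\<^sup>2) =
      (\<Sum>x\<in>P. \<Sum>y\<in>P. of_real (h x * h y) * (\<Prod>i<n. zchar r (S i * (x i - y i))))" for S
  proof -
    have "complex_of_real ((cmod (dft r n h S))\<^sup>2) = dft r n h S * cnj (dft r n h S)"
      by (rule complex_norm_square)
    also have "\<dots> = (\<Sum>x\<in>P. \<Sum>y\<in>P. (of_real (h x) * (\<Prod>i<n. zchar r (S i * x i))) *
        (of_real (h y) * (\<Prod>i<n. zchar r (- (S i * y i)))))"
      by (simp add: dft_def P_def Z_def sum_product cnj_zchar)
    also have "\<dots> = (\<Sum>x\<in>P. \<Sum>y\<in>P. of_real (h x * h y) * (\<Prod>i<n. zchar r (S i * (x i - y i))))"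
    proof (intro sum.cong refl)
      fix x y
      have "(\<Prod>i<n. zchar r (S i * (x i - y i))) =
          (\<Prod>i<n. zchar r (S i * x i)) * (\<Prod>i<n. zchar r (- (S i * y i)))"
        by (simp add: right_diff_distrib flip: prod.distrib zchar_add)
      then show "of_real (h x) * (\<Prod>i<n. zchar r (S i * x i)) *
        (of_real (h y) * (\<Prod>i<n. zchar r (- (S i * y i)))) =
        of_real (h x * h y) * (\<Prod>i<n. zchar r (S i * (x i - y i)))"
        by simp
    qed
    finally show ?thesis .
  qed
  have "complex_of_real ?L = (\<Sum>S\<in>P. (\<Prod>i<n. of_real (w (S i))) *
      (\<Sum>x\<in>P. \<Sum>y\<in>P. of_real (h x * h y) * (\<Prod>i<n. zchar r (S i * (x i - y i)))))"
    by (simp add: w_def[symmetric] P_def[symmetric] Z_def[symmetric] sq del: of_real_power)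
  also have "\<dots> = (\<Sum>S\<in>P. \<Sum>x\<in>P. \<Sum>y\<in>P. of_real (h x * h y) *
      (\<Prod>i<n. of_real (w (S i)) * zchar r (S i * (x i - y i))))"
    by (simp add: sum_distrib_left prod.distrib mult_ac)
  also have "\<dots> = (\<Sum>x\<in>P. \<Sum>y\<in>P. \<Sum>S\<in>P. of_real (h x * h y) *
      (\<Prod>i<n. of_real (w (S i)) * zchar r (S i * (x i - y i))))"
    by (subst sum.swap) (intro sum.cong refl sum.swap)
  also have "\<dots> = (\<Sum>x\<in>P. \<Sum>y\<in>P. of_real (h x * h y) *
      (\<Prod>i<n. complex_of_real (1 - \<delta> + \<delta> * real r * of_bool (x i = y i))))"
  proof (intro sum.cong refl)
    fix x y assume xy: "x \<in> P" "y \<in> P"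
    have "(\<Prod>i<n. complex_of_real (1 - \<delta> + \<delta> * real r * of_bool (x i = y i)))
        = (\<Prod>i<n. \<Sum>s\<in>Z. of_real (w s) * zchar r (s * (x i - y i)))"
      using xy by (intro prod.cong refl K[symmetric]) (auto simp: P_def)
    also have "\<dots> = (\<Sum>S\<in>P. \<Prod>i<n. of_real (w (S i)) * zchar r (S i * (x i - y i)))"
      unfolding P_def by (rule prod_sum_PiE) (auto simp: Z_def)
    finally show "(\<Sum>S\<in>P. of_real (h x * h y) * (\<Prod>i<n. of_real (w (S i)) * zchar r (S i * (x i - y i))))
      = of_real (h x * h y) * (\<Prod>i<n. complex_of_real (1 - \<delta> + \<delta> * real r * of_bool (x i = y i)))"
      by (simp add: sum_distrib_left)
  qed
  also have "\<dots> = complex_of_real ?R"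
    by (simp add: P_def Z_def)
  finally show ?thesis
    by (simp only: of_real_eq_iff)
qed

lemma dft_Parseval:
  assumes r: "r > 0"
  shows "(\<Sum>S\<in>{..<n} \<rightarrow>\<^sub>E {0..<int r}. (cmod (dft r n h S))\<^sup>2)
    = real r ^ n * (\<Sum>x\<in>{..<n} \<rightarrow>\<^sub>E {0..<int r}. (h x)\<^sup>2)"
proof -
  define P where "P = {..<n} \<rightarrow>\<^sub>E {0..<int r}"
  have finP: "finite P" by (auto simp: P_def intro!: finite_PiE)
  have "(\<Sum>S\<in>P. (cmod (dft r n h S))\<^sup>2) =
      (\<Sum>x\<in>P. \<Sum>y\<in>P. h x * h y * (\<Prod>i<n. real r * of_bool (x i = y i)))"
    using dft_energy[OF r, where n = n and \<delta> = 1 and h = h] by (simp add: P_def cong: if_cong)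
  also have "\<dots> = (\<Sum>x\<in>P. \<Sum>y\<in>P. if x = y then real r ^ n * (h x)\<^sup>2 else 0)"
  proof (intro sum.cong refl)
    fix x y assume xy: "x \<in> P" "y \<in> P"
    show "h x * h y * (\<Prod>i<n. real r * of_bool (x i = y i)) = (if x = y then real r ^ n * (h x)\<^sup>2 else 0)"
    proof (cases "x = y")
      case False
      then obtain i where "i < n" "x i \<noteq> y i"
        using xy PiE_ext[of x "{..<n}" _ y] unfolding P_def by blast
      then have "(\<Prod>i<n. real r * of_bool (x i = y i)) = 0"
        by (intro prod_zero) auto
      with False show ?thesis by simp
    qed (simp add: power2_eq_square)
  qed
  also have "\<dots> = real r ^ n * (\<Sum>x\<in>P. (h x)\<^sup>2)"
    using finP by (simp add: sum_distrib_left)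
  finally show ?thesis
    by (simp add: P_def)
qed

section \<open>Fourier weight of an indicator on one level\<close>

lemma sum_indicator_subset:
  assumes "finite P" "A \<subseteq> P"
  shows "(\<Sum>x\<in>P. indicator A x) = real (card A)"
  using assms by (simp add: indicator_def sum.If_cases Int_absorb1)

text \<open>Both functions of the bilinear inequality are the indicator, which equals its own p-th
  power, so its p-norm is a power of the cardinality.\<close>

lemma dft_indicator_hypercontractivity:
  assumes A: "A \<subseteq> {..<n} \<rightarrow>\<^sub>E {0..<int r}" and r: "2 \<le> r"
    and p: "1 < p" "p \<le> 2" and \<delta>: "\<delta> = (p - 1) / real r"
  shows "(\<Sum>S\<in>{..<n} \<rightarrow>\<^sub>E {0..<int r}.
      (\<Prod>i<n. if S i = 0 then 1 else \<delta>) * (cmod (dft r n (indicator A) S))\<^sup>2)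
    \<le> (real r ^ n) powr (2 - 2 / p) * real (card A) powr (2 / p)"
proof -
  define P where "P = {..<n} \<rightarrow>\<^sub>E {0..<int r}"
  have finP: "finite P" by (auto simp: P_def intro!: finite_PiE)
  have "(\<Sum>x\<in>P. indicator A x powr p) = (\<Sum>x\<in>P. indicator A x :: real)"
    using p by (intro sum.cong) (auto simp: indicator_def)
  also have "\<dots> = real (card A)"
    using A finP by (intro sum_indicator_subset) (auto simp: P_def)
  finally have card: "(\<Sum>x\<in>P. indicator A x powr p) = real (card A)" .
  have "(\<Sum>S\<in>P. (\<Prod>i<n. if S i = 0 then 1 else \<delta>) * (cmod (dft r n (indicator A) S))\<^sup>2)
      \<le> (real r powr (2 - 2 / p)) ^ n * real (card A) powr (1 / p) * real (card A) powr (1 / p)"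
  proof -
    have r0: "0 < r" using r by simp
    have "(\<Sum>x\<in>P. \<Sum>y\<in>P. indicator A x * indicator A y *
        (\<Prod>i<n. 1 - \<delta> + \<delta> * real r * of_bool (x i = y i)))
      \<le> (real r powr (2 - 2 / p)) ^ n * (\<Sum>x\<in>P. indicator A x powr p) powr (1 / p)
        * (\<Sum>x\<in>P. indicator A x powr p) powr (1 / p)"
      unfolding P_def by (rule hypercontractivity_bilinear[OF _ _ r p \<delta>]) auto
    then show ?thesis
      unfolding card unfolding P_def dft_energy[OF r0] .
  qed
  also have "\<dots> = (real r ^ n) powr (2 - 2 / p) * real (card A) powr (2 / p)"
  proof -
    have "(real r powr a) ^ n = (real r ^ n) powr a" for a
      using r by (simp add: powr_power powr_powr mult.commute flip: powr_realpow)
    then show ?thesis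
      by (simp add: mult.assoc flip: powr_add)
  qed
  finally show ?thesis
    by (simp add: P_def)
qed

text \<open>Every S on level j has the same weight \<delta>^j, so dividing by it isolates the level.
  In use j = t * k, and \<open>2 * k \<le> j\<close> is where t >= 2 enters.\<close>

lemma level_inequality:
  assumes A: "A \<subseteq> {..<n} \<rightarrow>\<^sub>E {0..<int r}" and r: "2 \<le> r"
    and c: "real r ^ n / 2 powr c \<le> real (card A)"
    and k: "1 \<le> k" "real k \<le> c" and j: "2 * k \<le> j"
  shows "(\<Sum>S | S \<in> {..<n} \<rightarrow>\<^sub>E {0..<int r} \<and> card {i\<in>{..<n}. S i \<noteq> 0} = j.
      (cmod (dft r n (indicator A) S))\<^sup>2) \<le> (2 * real r * c / real k) ^ j * (real (card A))\<^sup>2"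
proof -
  define P where "P = {..<n} \<rightarrow>\<^sub>E {0..<int r}"
  define L where "L = {S\<in>P. card {i\<in>{..<n}. S i \<noteq> 0} = j}"
  define F where "F S = (cmod (dft r n (indicator A) S))\<^sup>2" for S
  define p where "p = 1 + real k / c"
  define \<delta> where "\<delta> = (p - 1) / real r"
  have finP: "finite P" by (auto simp: P_def intro!: finite_PiE)
  have c0: "0 < c" and k0: "0 < real k" using k by auto
  have p: "1 < p" "p \<le> 2" using k c0 by (auto simp: p_def field_simps)
  have \<delta>0: "0 < \<delta>" using p r by (simp add: \<delta>_def)
  have "0 < real r ^ n / 2 powr c" using r by simp
  with c have A0: "0 < real (card A)" by linarith
  have w: "(\<Prod>i<n. if S i = 0 then 1 else \<delta>) = \<delta> ^ card {i\<in>{..<n}. S i \<noteq> 0}" for S :: "nat \<Rightarrow> int"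
    by (simp add: prod.If_cases Collect_neg_eq Int_def)
  have "\<delta> ^ j * (\<Sum>S\<in>L. F S) = (\<Sum>S\<in>L. (\<Prod>i<n. if S i = 0 then 1 else \<delta>) * F S)"
    unfolding sum_distrib_left by (intro sum.cong refl) (simp only: w, simp add: L_def)
  also have "\<dots> \<le> (\<Sum>S\<in>P. (\<Prod>i<n. if S i = 0 then 1 else \<delta>) * F S)"
    using finP \<delta>0 by (intro sum_mono2 mult_nonneg_nonneg prod_nonneg) (auto simp: L_def F_def)
  also have "\<dots> \<le> (real r ^ n) powr (2 - 2 / p) * real (card A) powr (2 / p)"
    unfolding P_def F_def by (intro dft_indicator_hypercontractivity A r p \<delta>_def)
  also have "\<dots> \<le> (2 powr c * real (card A)) powr (2 - 2 / p) * real (card A) powr (2 / p)"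
    using c p by (intro mult_right_mono powr_mono2) (auto simp: field_simps)
  also have "\<dots> = 2 powr (c * (2 - 2 / p)) * (real (card A))\<^sup>2"
    using A0 by (simp add: powr_mult powr_powr flip: powr_add)
  also have "\<dots> \<le> 2 powr (real j) * (real (card A))\<^sup>2"
  proof (intro mult_right_mono powr_mono)
    \<comment> \<open>The choice of \<open>p\<close> makes c (p - 1) = k, so the density loss 2^c
      enters only with an exponent of order k and is absorbed by 2^j.\<close>
    have "c * (2 - 2 / p) = 2 * real k / p"
      using p c0 by (simp add: p_def field_simps)
    also have "\<dots> \<le> 2 * real k"
      using p k0 by (simp add: field_simps)
    also have "\<dots> \<le> real j"
      using j by linarith
    finally show "c * (2 - 2 / p) \<le> real j" .
  qed auto
  finally have "(\<Sum>S\<in>L. F S) \<le> (2 / \<delta>) ^ j * (real (card A))\<^sup>2"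
    using \<delta>0 by (simp add: powr_realpow field_simps)
  also have "2 / \<delta> = 2 * real r * c / real k"
    using r c0 k0 by (simp add: \<delta>_def p_def)
  finally show ?thesis
    by (simp add: L_def F_def P_def)
qed

lemma sum_dft_indicator_le:
  assumes A: "A \<subseteq> {..<n} \<rightarrow>\<^sub>E {0..<int r}" and r: "0 < r"
    and c: "real r ^ n / 2 powr c \<le> real (card A)"
    and L: "L \<subseteq> {..<n} \<rightarrow>\<^sub>E {0..<int r}"
  shows "(\<Sum>S\<in>L. (cmod (dft r n (indicator A) S))\<^sup>2) \<le> 2 powr c * (real (card A))\<^sup>2"
proof -
  define P where "P = {..<n} \<rightarrow>\<^sub>E {0..<int r}"
  have finP: "finite P" by (auto simp: P_def intro!: finite_PiE)
  have "(\<Sum>S\<in>L. (cmod (dft r n (indicator A) S))\<^sup>2) \<le> (\<Sum>S\<in>P. (cmod (dft r n (indicator A) S))\<^sup>2)"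
    using L finP by (intro sum_mono2) (auto simp: P_def)
  also have "\<dots> = real r ^ n * (\<Sum>x\<in>P. (indicator A x)\<^sup>2)"
    unfolding P_def by (rule dft_Parseval[OF r])
  also have "(\<Sum>x\<in>P. (indicator A x)\<^sup>2) = (\<Sum>x\<in>P. indicator A x :: real)"
    by (intro sum.cong) (auto simp: indicator_def)
  also have "\<dots> = real (card A)"
    using A finP by (intro sum_indicator_subset) (auto simp: P_def)
  also have "real r ^ n * real (card A) \<le> (2 powr c * real (card A)) * real (card A)"
    using c by (intro mult_right_mono) (auto simp: field_simps)
  finally show ?thesis
    by (simp add: power2_eq_square mult_ac)
qed

section \<open>Unions of hyperedges, and how often a set is one\<close>

definition matched :: "nat set list \<Rightarrow> nat set \<Rightarrow> bool" where
  "matched M T \<longleftrightarrow> (\<exists>J\<subseteq>{..<length M}. T = (\<Union>j\<in>J. M ! j))"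

lemma card_UN_hyperedges:
  assumes "M \<in> hypermatchings \<alpha> t n" "J \<subseteq> {..<length M}"
  shows "card (\<Union>j\<in>J. M ! j) = t * card J"
proof -
  have *: "M ! j \<subseteq> {..<n}" "card (M ! j) = t" if "j \<in> J" for j
  proof -
    have "M ! j \<in> set M"
      using that assms(2) by auto
    then show "M ! j \<subseteq> {..<n}" "card (M ! j) = t"
      using assms(1) by (auto simp: hypermatchings_def simp del: in_set_conv_nth)
  qed
  have "card (\<Union>j\<in>J. M ! j) = (\<Sum>j\<in>J. card (M ! j))"
  proof (rule card_UN_disjoint)
    show "finite J" using assms(2) finite_subset by blast
    show "\<forall>j\<in>J. finite (M ! j)" using * finite_subset by blast
    show "\<forall>i\<in>J. \<forall>j\<in>J. i \<noteq> j \<longrightarrow> M ! i \<inter> M ! j = {}"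
      using assms(1) subsetD[OF assms(2)] unfolding hypermatchings_def disjoint_family_on_def by blast
  qed
  then show ?thesis
    using * by simp
qed

lemma ex_permutation_of_card_eq:
  assumes "finite U" "S \<subseteq> U" "T \<subseteq> U" "card S = card T"
  shows "\<exists>\<pi>. bij_betw \<pi> U U \<and> \<pi> ` S = T"
proof -
  have fin: "finite S" "finite T"
    using assms finite_subset by blast+
  obtain f where f: "bij_betw f S T"
    using assms(4) fin finite_same_card_bij[of S T] by auto
  have "card (U - S) = card (U - T)"
    using assms fin by (simp add: card_Diff_subset)
  then obtain g where g: "bij_betw g (U - S) (U - T)"
    using assms(1) finite_same_card_bij[of "U - S" "U - T"] by auto
  define \<pi> where "\<pi> x = (if x \<in> S then f x else g x)" for x
  have "bij_betw \<pi> S T"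
    using f by (subst bij_betw_cong[of _ _ f]) (auto simp: \<pi>_def)
  moreover have "bij_betw \<pi> (U - S) (U - T)"
    using g by (subst bij_betw_cong[of _ _ g]) (auto simp: \<pi>_def)
  ultimately have "bij_betw \<pi> (S \<union> (U - S)) (T \<union> (U - T))"
    by (intro bij_betw_combine) auto
  moreover have "\<pi> ` S = T"
    using \<open>bij_betw \<pi> S T\<close> by (rule bij_betw_imp_surj_on)
  ultimately show ?thesis
    using assms by (metis Un_Diff_cancel Un_absorb1)
qed

text \<open>A permutation of the ground set taking S to T acts on hypermatchings edge by edge; this
  action is injective and carries unions of hyperedges to unions of hyperedges.\<close>

lemma card_matched_le:
  assumes "S \<subseteq> {..<n}" "T \<subseteq> {..<n}" "card S = card T"
  shows "card {M \<in> hypermatchings \<alpha> t n. matched M S} \<le> card {M \<in> hypermatchings \<alpha> t n. matched M T}"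
proof -
  obtain \<pi> where \<pi>: "bij_betw \<pi> {..<n} {..<n}" "\<pi> ` S = T"
    using ex_permutation_of_card_eq[of "{..<n}" S T] assms by auto
  have inj: "inj_on \<pi> {..<n}" and im: "\<pi> ` {..<n} = {..<n}"
    using \<pi> by (auto simp: bij_betw_def)
  have edge: "M ! i \<subseteq> {..<n}" "card (M ! i) = t" if "M \<in> hypermatchings \<alpha> t n" "i < length M" for M i
    using that by (auto simp: hypermatchings_def)
  show ?thesis
  proof (rule card_inj_on_le)
    show "inj_on (map ((`) \<pi>)) {M \<in> hypermatchings \<alpha> t n. matched M S}"
    proof (rule inj_onI)
      fix M M' assume M: "M \<in> {M \<in> hypermatchings \<alpha> t n. matched M S}"
        "M' \<in> {M \<in> hypermatchings \<alpha> t n. matched M S}" and eq: "map ((`) \<pi>) M = map ((`) \<pi>) M'"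
      have len: "length M = length M'"
        using arg_cong[OF eq, of length] by simp
      show "M = M'"
      proof (rule nth_equalityI[OF len])
        fix i assume i: "i < length M"
        have "\<pi> ` (M ! i) = \<pi> ` (M' ! i)"
          using arg_cong[OF eq, of "\<lambda>l. l ! i"] i len by simp
        then show "M ! i = M' ! i"
          using inj_on_image_eq_iff[OF inj] edge M i len by simp
      qed
    qed
    show "map ((`) \<pi>) ` {M \<in> hypermatchings \<alpha> t n. matched M S}
      \<subseteq> {M \<in> hypermatchings \<alpha> t n. matched M T}"
    proof (rule image_subsetI)
      fix M assume "M \<in> {M \<in> hypermatchings \<alpha> t n. matched M S}"
      then have M: "M \<in> hypermatchings \<alpha> t n" and "matched M S" by auto
      then obtain J where J: "J \<subseteq> {..<length M}" "S = (\<Union>j\<in>J. M ! j)"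
        by (auto simp: matched_def)
      have "T = (\<Union>j\<in>J. map ((`) \<pi>) M ! j)"
        unfolding \<pi>(2)[symmetric] J(2) image_UN using J(1) by (intro SUP_cong) auto
      then have "matched (map ((`) \<pi>) M) T"
        unfolding matched_def using J(1) by auto
      moreover have "map ((`) \<pi>) M \<in> hypermatchings \<alpha> t n"
        unfolding hypermatchings_def mem_Collect_eq
      proof (intro conjI ballI)
        show "real (length (map ((`) \<pi>) M)) = \<alpha> * real n / real t"
          using M by (simp add: hypermatchings_def)
        fix e assume "e \<in> set (map ((`) \<pi>) M)"
        then obtain e' where e': "e' \<in> set M" "e = \<pi> ` e'" by auto
        then have "e' \<subseteq> {..<n}" "card e' = t"
          using M by (auto simp: hypermatchings_def)
        then show "e \<subseteq> {..<n}" "card e = t"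
          using e' im inj card_image inj_on_subset by (blast, metis)
      next
        show "disjoint_family_on (\<lambda>i. map ((`) \<pi>) M ! i) {..<length (map ((`) \<pi>) M)}"
          unfolding disjoint_family_on_def
        proof (intro ballI impI)
          fix i j assume ij: "i \<in> {..<length (map ((`) \<pi>) M)}" "j \<in> {..<length (map ((`) \<pi>) M)}" "i \<noteq> j"
          then have "M ! i \<inter> M ! j = {}"
            using M by (auto simp: hypermatchings_def disjoint_family_on_def)
          moreover have "\<pi> ` (M ! i) \<inter> \<pi> ` (M ! j) = \<pi> ` (M ! i \<inter> M ! j)"
            using inj_on_image_Int[OF inj] edge[OF M] ij by simp
          ultimately show "map ((`) \<pi>) M ! i \<inter> map ((`) \<pi>) M ! j = {}"
            using ij by simp
        qed
      qed
      ultimately show "map ((`) \<pi>) M \<in> {M \<in> hypermatchings \<alpha> t n. matched M T}"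
        by simp
    qed
    show "finite {M \<in> hypermatchings \<alpha> t n. matched M T}"
      using finite_hypermatchings by simp
  qed
qed

text \<open>Double counting: by symmetry under permutations of the ground set, all sets of the same size are
  matched equally often.\<close>
lemma card_matched_times_choose_le:
  assumes T: "T \<subseteq> {..<n}" "card T = t * k" and t: "0 < t"
    and m: "real m = \<alpha> * real n / real t"
  shows "card {M \<in> hypermatchings \<alpha> t n. matched M T} * (n choose (t * k))
    \<le> card (hypermatchings \<alpha> t n) * (m choose k)"
proof -
  define H where "H = hypermatchings \<alpha> t n"
  define Ts where "Ts = {T. T \<subseteq> {..<n} \<and> card T = t * k}"
  have finH: "finite H" by (simp add: H_def finite_hypermatchings)
  have finTs: "finite Ts" by (rule finite_subset[of _ "Pow {..<n}"]) (auto simp: Ts_def)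
  have "card Ts = n choose (t * k)"
    using n_subsets[of "{..<n}" "t * k"] by (simp add: Ts_def)
  then have "card {M \<in> H. matched M T} * (n choose (t * k)) = (\<Sum>T'\<in>Ts. card {M \<in> H. matched M T})"
    by simp
  \<comment> \<open>T is compared with every set of its size, which bounds its count by the
    average.\<close>
  also have "\<dots> \<le> (\<Sum>T'\<in>Ts. card {M \<in> H. matched M T'})"
    unfolding H_def using T by (intro sum_mono card_matched_le) (auto simp: Ts_def)
  also have "\<dots> = (\<Sum>M\<in>H. card {T' \<in> Ts. matched M T'})"
    using sum_multicount_gen[OF finTs finH, where R = "\<lambda>T' M. matched M T'"
        and k = "\<lambda>M. card {T' \<in> Ts. matched M T'}"] by simp
  also have "\<dots> \<le> (\<Sum>M\<in>H. m choose k)"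
  proof (rule sum_mono)
    fix M assume M: "M \<in> H"
    then have len: "length M = m"
      using m by (simp add: H_def hypermatchings_def)
    \<comment> \<open>Disjoint edges of size t > 0 force |J| = k, so there are at most as many
      matched sets as there are such J.\<close>
    have "{T' \<in> Ts. matched M T'} \<subseteq> (\<lambda>J. \<Union>j\<in>J. M ! j) ` {J. J \<subseteq> {..<m} \<and> card J = k}"
    proof
      fix T' assume "T' \<in> {T' \<in> Ts. matched M T'}"
      then obtain J where J: "J \<subseteq> {..<m}" "T' = (\<Union>j\<in>J. M ! j)" "card T' = t * k"
        by (auto simp: matched_def Ts_def len)
      have "card T' = t * card J"
        unfolding J(2) using M J(1) len by (intro card_UN_hyperedges) (auto simp: H_def)
      with J(3) have "t * card J = t * k"
        by metis
      then show "T' \<in> (\<lambda>J. \<Union>j\<in>J. M ! j) ` {J. J \<subseteq> {..<m} \<and> card J = k}"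
        using J(1,2) t by (intro image_eqI[where x = J]) auto
    qed
    then have "card {T' \<in> Ts. matched M T'} \<le> card {J. J \<subseteq> {..<m} \<and> card J = k}"
      by (rule surj_card_le[rotated]) (rule finite_subset[of _ "Pow {..<m}"], auto)
    also have "\<dots> = m choose k"
      using n_subsets[of "{..<m}" k] by simp
    finally show "card {T' \<in> Ts. matched M T'} \<le> m choose k" .
  qed
  finally show ?thesis
    by (simp add: H_def)
qed

section \<open>Pulling frequencies back along the incidence matrix\<close>

text \<open>The vector $M^T V$.  For a hypermatching at most one summand is nonzero, so no reduction modulo
  $r$ is needed.\<close>
definition spread :: "nat \<Rightarrow> nat set list \<Rightarrow> (nat \<Rightarrow> int) \<Rightarrow> nat \<Rightarrow> int" where
  "spread n M V = restrict (\<lambda>i. \<Sum>j<length M. if i \<in> M ! j then V j else 0) {..<n}"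

lemma spread_in_edge:
  assumes "M \<in> hypermatchings \<alpha> t n" "j < length M" "i \<in> M ! j"
  shows "spread n M V i = V j"
proof -
  have "M ! j \<subseteq> {..<n}"
    using assms(1,2) by (auto simp: hypermatchings_def simp del: in_set_conv_nth)
  moreover have "i \<notin> M ! j'" if "j' < length M" "j' \<noteq> j" for j'
    using assms that unfolding hypermatchings_def disjoint_family_on_def by blast
  then have "(\<Sum>j'<length M. if i \<in> M ! j' then V j' else 0) = (\<Sum>j'<length M. if j' = j then V j else 0)"
    using assms(3) by (intro sum.cong) auto
  ultimately show ?thesis
    using assms(2,3) by (auto simp: spread_def)
qed

lemma spread_outside:
  assumes "i < n" "\<And>j. j < length M \<Longrightarrow> i \<notin> M ! j"
  shows "spread n M V i = 0"
  using assms by (auto simp: spread_def intro!: sum.neutral)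

lemma spread_in_PiE:
  assumes M: "M \<in> hypermatchings \<alpha> t n" and "0 < r" and V: "V \<in> {..<length M} \<rightarrow>\<^sub>E {0..<int r}"
  shows "spread n M V \<in> {..<n} \<rightarrow>\<^sub>E {0..<int r}"
proof (rule PiE_I)
  fix i assume "i \<in> {..<n}"
  show "spread n M V i \<in> {0..<int r}"
  proof (cases "\<exists>j<length M. i \<in> M ! j")
    case True
    then show ?thesis
      using spread_in_edge[OF M] V by (metis PiE_mem lessThan_iff)
  next
    case False
    then show ?thesis
      using \<open>i \<in> {..<n}\<close> \<open>0 < r\<close> spread_outside by force
  qed
qed (simp add: spread_def)

text \<open>Since t > 0, every hyperedge has a point, and V j can be read off there. Distinct V
  therefore use distinct Fourier coefficients of A.\<close>

lemma inj_on_spread: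
  assumes M: "M \<in> hypermatchings \<alpha> t n" and t: "0 < t"
  shows "inj_on (spread n M) ({..<length M} \<rightarrow>\<^sub>E Z)"
proof (rule inj_onI)
  fix V W assume V: "V \<in> {..<length M} \<rightarrow>\<^sub>E Z" and W: "W \<in> {..<length M} \<rightarrow>\<^sub>E Z"
    and eq: "spread n M V = spread n M W"
  show "V = W"
  proof (rule PiE_ext[OF V W])
    fix j assume j: "j \<in> {..<length M}"
    then have "card (M ! j) = t"
      using M by (auto simp: hypermatchings_def simp del: in_set_conv_nth)
    then obtain i where "i \<in> M ! j"
      using t by (metis card.empty ex_in_conv less_numeral_extra(3))
    then show "V j = W j"
      using spread_in_edge[OF M, of j i] j eq by (metis lessThan_iff)
  qed
qed

text \<open>Hyperedges do not overlap, so no cancellation is possible. This is what makes the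
  support \<open>matched\<close>.\<close>

lemma support_spread:
  assumes M: "M \<in> hypermatchings \<alpha> t n"
  shows "{i \<in> {..<n}. spread n M V i \<noteq> 0} = (\<Union>j\<in>{j \<in> {..<length M}. V j \<noteq> 0}. M ! j)"
proof -
  have edge: "M ! j \<subseteq> {..<n}" if "j < length M" for j
    using M that by (auto simp: hypermatchings_def simp del: in_set_conv_nth)
  show ?thesis
  proof (intro equalityI subsetI)
    fix i assume i: "i \<in> {i \<in> {..<n}. spread n M V i \<noteq> 0}"
    then obtain j where j: "j < length M" "i \<in> M ! j"
      using spread_outside[of i n M V] by auto
    then have "V j \<noteq> 0"
      using spread_in_edge[OF M j, of V] i by simp
    with j show "i \<in> (\<Union>j\<in>{j \<in> {..<length M}. V j \<noteq> 0}. M ! j)"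
      by blast
  next
    fix i assume "i \<in> (\<Union>j\<in>{j \<in> {..<length M}. V j \<noteq> 0}. M ! j)"
    then obtain j where j: "j < length M" "V j \<noteq> 0" "i \<in> M ! j"
      by blast
    then show "i \<in> {i \<in> {..<n}. spread n M V i \<noteq> 0}"
      using spread_in_edge[OF M j(1,3), of V] edge by auto
  qed
qed

text \<open>Adjointness <V, M x> = <M^T V, x>, read through characters, which do not see the
  reduction modulo r.\<close>

lemma prod_zchar_mult_mod:
  assumes r: "0 < r" and x: "x \<in> carrier_vec n"
  shows "(\<Prod>j<length M. zchar r (V j * vec_index (mult_mod r (incidence_mat n M) x) j))
    = (\<Prod>i<n. zchar r (spread n M V i * vec_index x i))"
proof -
  have idx: "vec_index (mult_mod r (incidence_mat n M) x) j
      = (\<Sum>i<n. (if i \<in> M ! j then 1 else 0) * vec_index x i) mod int r" if "j < length M" for j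
    using that x by (simp add: mult_mod_def incidence_mat_def scalar_prod_def lessThan_atLeast0)
  have "(\<Prod>j<length M. zchar r (V j * vec_index (mult_mod r (incidence_mat n M) x) j))
      = (\<Prod>j<length M. zchar r (V j * (\<Sum>i<n. (if i \<in> M ! j then 1 else 0) * vec_index x i)))"
    by (intro prod.cong refl) (simp add: idx zchar_mult_mod r)
  also have "\<dots> = zchar r (\<Sum>j<length M. \<Sum>i<n. (if i \<in> M ! j then V j else 0) * vec_index x i)"
    unfolding zchar_sum[symmetric] sum_distrib_left
    by (intro arg_cong[of _ _ "zchar r"] sum.cong) auto
  also have "\<dots> = zchar r (\<Sum>i<n. spread n M V i * vec_index x i)"
    by (subst sum.swap) (simp add: spread_def sum_distrib_right)
  finally show ?thesis
    by (simp add: zchar_sum)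
qed

lemma sum_zvecs: "(\<Sum>x\<in>zvecs r n. f x) = (\<Sum>x\<in>{..<n} \<rightarrow>\<^sub>E {0..<int r}. f (vec n x))"
  by (rule sum.reindex_bij_betw[OF bij_betw_zvecs, symmetric])

text \<open>Pushing a distribution forward along M pulls frequencies back along M^T. The set under
  \<open>indicator\<close> is A itself, transported from vectors to the functions on which
  \<open>dft\<close> works.\<close>

lemma dft_image_dist:
  assumes r: "0 < r" and A: "A \<subseteq> zvecs r n" "A \<noteq> {}"
  shows "dft r (length M) (\<lambda>z. pmf (image_dist r n A M) (vec (length M) z)) V
    = dft r n (indicator {x \<in> {..<n} \<rightarrow>\<^sub>E {0..<int r}. vec n x \<in> A}) (spread n M V) / of_nat (card A)"
proof -
  let ?\<phi> = "mult_mod r (incidence_mat n M)"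
  let ?m = "length M"
  define \<chi> where "\<chi> z = (\<Prod>j<?m. zchar r (V j * vec_index z j))" for z
  define \<psi> where "\<psi> x = (\<Prod>i<n. zchar r (spread n M V i * vec_index x i))" for x
  have finA: "finite A" using A finite_zvecs finite_subset by blast
  have "dft r ?m (\<lambda>z. pmf (image_dist r n A M) (vec ?m z)) V
      = (\<Sum>z\<in>zvecs r ?m. of_real (pmf (image_dist r n A M) z) * \<chi> z)"
    by (simp add: dft_def sum_zvecs \<chi>_def)
  \<comment> \<open>Each fibre cardinality is opened into a sum over A; after the swap only z = M x
    survives.\<close>
  also have "\<dots> = (\<Sum>z\<in>zvecs r ?m. \<Sum>x\<in>A. if ?\<phi> x = z then \<chi> z / of_nat (card A) else 0)"
  proof (intro sum.cong refl)
    fix z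
    have "real (card {x \<in> A. ?\<phi> x = z}) = (\<Sum>x\<in>A. if ?\<phi> x = z then 1 else 0)"
      using finA by (simp add: sum.If_cases Int_def)
    then have "of_real (pmf (image_dist r n A M) z) * \<chi> z
        = (\<Sum>x\<in>A. of_real (if ?\<phi> x = z then 1 else 0) * \<chi> z / of_nat (card A))"
      using finA A by (simp add: pmf_image_dist sum_divide_distrib sum_distrib_right)
    also have "\<dots> = (\<Sum>x\<in>A. if ?\<phi> x = z then \<chi> z / of_nat (card A) else 0)"
      by (intro sum.cong) auto
    finally show "of_real (pmf (image_dist r n A M) z) * \<chi> z
        = (\<Sum>x\<in>A. if ?\<phi> x = z then \<chi> z / of_nat (card A) else 0)" .
  qed
  also have "\<dots> = (\<Sum>x\<in>A. \<Sum>z\<in>zvecs r ?m. if ?\<phi> x = z then \<chi> z / of_nat (card A) else 0)"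
    by (rule sum.swap)
  also have "\<dots> = (\<Sum>x\<in>A. \<chi> (?\<phi> x) / of_nat (card A))"
    using mult_mod_in_zvecs[OF r] by (simp add: finite_zvecs)
  also have "\<dots> = (\<Sum>x\<in>A. \<psi> x) / of_nat (card A)"
    unfolding sum_divide_distrib \<chi>_def \<psi>_def using A prod_zchar_mult_mod[OF r]
    by (intro sum.cong) (auto simp: zvecs_def)
  also have "(\<Sum>x\<in>A. \<psi> x) = (\<Sum>x\<in>zvecs r n. of_real (indicator A x) * \<psi> x)"
    using A finite_zvecs by (intro sum.mono_neutral_cong_left) (auto simp: indicator_def)
  also have "\<dots> = dft r n (indicator {x \<in> {..<n} \<rightarrow>\<^sub>E {0..<int r}. vec n x \<in> A}) (spread n M V)"
    by (auto simp: sum_zvecs dft_def \<psi>_def indicator_def intro!: sum.cong)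
  finally show ?thesis .
qed

section \<open>Distance from uniform in Fourier terms\<close>

lemma sum_sq_diff_uniform:
  fixes p :: "'a pmf"
  assumes Z: "finite Z" "Z \<noteq> {}" "set_pmf p \<subseteq> Z"
  shows "(\<Sum>z\<in>Z. (pmf p z - pmf (pmf_of_set Z) z)\<^sup>2) = (\<Sum>z\<in>Z. (pmf p z)\<^sup>2) - 1 / real (card Z)"
proof -
  have "(\<Sum>z\<in>Z. (pmf p z - pmf (pmf_of_set Z) z)\<^sup>2)
      = (\<Sum>z\<in>Z. (pmf p z)\<^sup>2 - 2 / real (card Z) * pmf p z + (1 / real (card Z))\<^sup>2)"
    using Z by (intro sum.cong) (auto simp: power2_diff)
  also have "\<dots> = (\<Sum>z\<in>Z. (pmf p z)\<^sup>2) - 2 / real (card Z) * (\<Sum>z\<in>Z. pmf p z) + real (card Z) * (1 / real (card Z))\<^sup>2"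
    by (simp add: sum.distrib sum_subtractf sum_distrib_left)
  also have "(\<Sum>z\<in>Z. pmf p z) = 1"
    using Z by (intro sum_pmf_eq_1) auto
  finally show ?thesis
    using Z by (simp add: power2_eq_square)
qed

text \<open>Cauchy-Schwarz over the r^m points leaves r^m times the collision probability, minus 1.
  Parseval turns the first term into the sum over all V, and the 1 is precisely the zero frequency,
  whose coefficient is the total mass.\<close>

lemma tvd_uniform_sq_le:
  assumes r: "0 < r" and p: "set_pmf p \<subseteq> zvecs r m"
  shows "(tvd (zvecs r m) p (pmf_of_set (zvecs r m)))\<^sup>2
    \<le> (\<Sum>V\<in>({..<m} \<rightarrow>\<^sub>E {0..<int r}) - {\<lambda>j\<in>{..<m}. 0}. (cmod (dft r m (\<lambda>z. pmf p (vec m z)) V))\<^sup>2)"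
proof -
  define P where "P = {..<m} \<rightarrow>\<^sub>E {0..<int r}"
  define F where "F V = (cmod (dft r m (\<lambda>z. pmf p (vec m z)) V))\<^sup>2" for V
  have finP: "finite P" by (auto simp: P_def intro!: finite_PiE)
  have card: "real (card (zvecs r m)) = real r ^ m"
    by (simp add: card_zvecs)
  have ne: "zvecs r m \<noteq> {}"
    using r card_zvecs[of r m] by auto
  have "(tvd (zvecs r m) p (pmf_of_set (zvecs r m)))\<^sup>2
      \<le> (\<Sum>z\<in>zvecs r m. \<bar>pmf p z - pmf (pmf_of_set (zvecs r m)) z\<bar>\<^sup>2) * real (card (zvecs r m))"
    unfolding tvd_def by (rule sum_squared_le_sum_of_squares)
  also have "\<dots> = real r ^ m * (\<Sum>z\<in>zvecs r m. (pmf p z)\<^sup>2) - 1"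
    using r p ne
    by (simp only: power2_abs sum_sq_diff_uniform[OF finite_zvecs ne p] card) (simp add: field_simps)
  also have "real r ^ m * (\<Sum>z\<in>zvecs r m. (pmf p z)\<^sup>2) = (\<Sum>V\<in>P. F V)"
    by (simp add: sum_zvecs P_def F_def dft_Parseval[OF r])
  also have "\<dots> = F (\<lambda>j\<in>{..<m}. 0) + (\<Sum>V\<in>P - {\<lambda>j\<in>{..<m}. 0}. F V)"
    using finP r by (intro sum.remove) (auto simp: P_def)
  also have "F (\<lambda>j\<in>{..<m}. 0) = 1"
  proof -
    have "dft r m (\<lambda>z. pmf p (vec m z)) (\<lambda>j\<in>{..<m}. 0) = of_real (\<Sum>z\<in>zvecs r m. pmf p z)"
      by (simp add: dft_def sum_zvecs)
    also have "(\<Sum>z\<in>zvecs r m. pmf p z) = 1"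
      using p finite_zvecs by (intro sum_pmf_eq_1) auto
    finally show ?thesis
      by (simp only: F_def) simp
  qed
  finally show ?thesis
    by (simp only: P_def F_def add_diff_cancel_left')
qed

section \<open>Binomial ratios and the geometric series\<close>

text \<open>The left factor 2 comes from $m \le n / (2t)$, that is, from $\alpha \le 1/2$.\<close>
lemma choose_ratio_halves:
  assumes "1 \<le> k" "k < m" "2 * t * m \<le> n" "0 < t"
  shows "2 * (m choose Suc k) * (n choose (t * k)) \<le> (m choose k) * (n choose (t * Suc k))"
proof -
  have absorb: "Suc l * (N choose Suc l) = (N - l) * (N choose l)" for N l
    by (simp only: binomial_absorption binomial_absorb_comp)
  \<comment> \<open>One below t (k + 1), so a single absorption step reaches the binomial
    coefficient of the next level; moving from t k up to \<open>l\<close> cannot decrease it, as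
    \<open>l\<close> stays below n / 2.\<close>
  define l where "l = t * k + (t - 1)"
  have l: "Suc l = t * Suc k"
    using assms by (simp add: l_def)
  have "t * Suc k \<le> t * m"
    using assms by (intro mult_le_mono2) simp
  then have ln: "2 * Suc l \<le> n"
    unfolding l using assms(3) by (simp only: mult.assoc)
  have "n choose (t * k) \<le> n choose l"
    using ln by (intro binomial_mono) (auto simp: l_def)
  \<comment> \<open>Here k >= 1 enters: l < t k + t <= 2 t k.\<close>
  moreover have "2 * t * (m - k) \<le> n - l"
  proof -
    have "t \<le> t * k" using assms by simp
    moreover have "2 * t * (m - k) = 2 * t * m - 2 * (t * k)"
      by (simp add: right_diff_distrib' mult.assoc)
    moreover have "l < t * k + t"
      using assms by (simp add: l_def)
    ultimately show ?thesis
      using assms(3) by linarith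
  qed
  ultimately have "2 * t * (m - k) * (n choose (t * k)) \<le> (n - l) * (n choose l)"
    by (intro mult_le_mono)
  also have "\<dots> = t * Suc k * (n choose (t * Suc k))"
    using absorb[of l n] by (simp only: l)
  finally have *: "2 * t * (m - k) * (n choose (t * k)) \<le> t * Suc k * (n choose (t * Suc k))" .
  have "t * Suc k * (2 * (m choose Suc k) * (n choose (t * k)))
      = 2 * t * (Suc k * (m choose Suc k)) * (n choose (t * k))"
    by (simp only: mult_ac)
  also have "\<dots> = (m choose k) * (2 * t * (m - k) * (n choose (t * k)))"
    by (simp only: absorb mult_ac)
  also have "\<dots> \<le> (m choose k) * (t * Suc k * (n choose (t * Suc k)))"
    using * by (intro mult_le_mono2)
  also have "\<dots> = t * Suc k * ((m choose k) * (n choose (t * Suc k)))"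
    by (simp only: mult_ac)
  finally show ?thesis
    using assms(4) by (simp only: mult_le_cancel1) simp
qed

text \<open>From (m choose k) <= m^k and (n choose t k) >= (n / (t k))^(t k). For y = 2 r c / k the
  factor k cancels, leaving the k-th power of a quantity independent of k.\<close>

lemma choose_ratio_le:
  fixes y :: real
  assumes k: "1 \<le> k" "k \<le> m" and n: "t * m \<le> n" "0 < t" and y: "0 \<le> y"
  shows "real (m choose k) / real (n choose (t * k)) * y ^ (t * k)
    \<le> (real m * (real t * real k * y / real n) ^ t) ^ k"
proof -
  have "t * k \<le> t * m" using k by simp
  then have tk: "t * k \<le> n" "0 < t * k"
    using n k le_trans by (blast, simp)
  have n0: "0 < real n" using tk by linarith
  have "(real n / real (t * k)) ^ (t * k) \<le> real (n choose (t * k))"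
    using binomial_ge_n_over_k_pow_k[OF tk(1), where ?'a = real] by simp
  moreover have "real (m choose k) \<le> real m ^ k"
    using binomial_le_pow[OF k(2)] by (simp flip: of_nat_power)
  ultimately have "real (m choose k) / real (n choose (t * k)) \<le> real m ^ k / (real n / real (t * k)) ^ (t * k)"
    using tk n0 by (intro frac_le) auto
  then have "real (m choose k) / real (n choose (t * k)) * y ^ (t * k)
      \<le> real m ^ k / (real n / real (t * k)) ^ (t * k) * y ^ (t * k)"
    using y by (intro mult_right_mono) auto
  also have "\<dots> = real m ^ k * (real t * real k * y / real n) ^ (t * k)"
    by (simp add: power_divide power_mult_distrib)
  also have "\<dots> = (real m * (real t * real k * y / real n) ^ t) ^ k"
    by (simp add: power_mult_distrib power_mult)
  finally show ?thesis .
qed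

text \<open>In use \<open>w k\<close> is the Fourier weight of level t k divided by |A|^2, and
  \<beta> bounds the quantity whose k-th powers arise from \<open>choose_ratio_le\<close>. As
  \<beta> <= 1/2, its k-th power is at most 2 \<beta> (1/2)^k.\<close>

lemma weighted_choose_ratio_sum_le:
  fixes w :: "nat \<Rightarrow> real" and c \<beta> :: real
  assumes n: "2 * t * m \<le> n" "0 < t" and r: "2 \<le> r" and c: "1 \<le> c"
    and \<beta>: "real m * (2 * real r * c * real t / real n) ^ t \<le> \<beta>" "\<beta> \<le> 1 / 2"
    and w1: "\<And>k. 1 \<le> k \<Longrightarrow> real k \<le> c \<Longrightarrow> w k \<le> (2 * real r * c / real k) ^ (t * k)"
    and w2: "\<And>k. w k \<le> 2 powr c"
  shows "(\<Sum>k=1..m. real (m choose k) / real (n choose (t * k)) * w k) \<le> 2 * \<beta>"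
proof -
  define a where "a k = real (m choose k) / real (n choose (t * k))" for k
  have a0: "0 \<le> a k" for k by (simp add: a_def)
  have "0 \<le> real m * (2 * real r * c * real t / real n) ^ t"
    using c by simp
  with \<beta> have \<beta>0: "0 \<le> \<beta>" by linarith
  \<comment> \<open>Stated without k <= c, because the induction for the tail starts from it at
    \<open>k1\<close> > c.\<close>
  have main: "a k * (2 * real r * c / real k) ^ (t * k) \<le> 2 * \<beta> * (1 / 2) ^ k" if k: "1 \<le> k" "k \<le> m" for k
  proof -
    have "a k * (2 * real r * c / real k) ^ (t * k)
        \<le> (real m * (real t * real k * (2 * real r * c / real k) / real n) ^ t) ^ k"
      unfolding a_def using k n c by (intro choose_ratio_le) auto
    also have "real t * real k * (2 * real r * c / real k) / real n = 2 * real r * c * real t / real n"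
      using k by simp
    also have "(real m * (2 * real r * c * real t / real n) ^ t) ^ k \<le> \<beta> ^ k"
      using \<beta> c by (intro power_mono) auto
    also have "\<beta> ^ k = \<beta> * \<beta> ^ (k - 1)"
      using k by (simp flip: power_Suc)
    also have "\<dots> \<le> \<beta> * (1 / 2) ^ (k - 1)"
      using \<beta> \<beta>0 by (intro mult_left_mono power_mono) auto
    also have "\<dots> = 2 * \<beta> * (1 / 2) ^ k"
      using k by (simp add: power_diff)
    finally show ?thesis .
  qed
  \<comment> \<open>The first integer above c. As c >= 1, it is at most 2 c, so 2 r c /
    \<open>k1\<close> >= r >= 2 and the Parseval bound 2^c is still below (2 r c /
    \<open>k1\<close>)^(t \<open>k1\<close>).\<close>
  define k1 where "k1 = nat \<lfloor>c\<rfloor> + 1"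
  have k1: "c < real k1" "real k1 \<le> 2 * c" "2 \<le> k1"
    using c by (auto simp: k1_def) linarith+
  have tail: "a k * 2 powr c \<le> 2 * \<beta> * (1 / 2) ^ k" if "k1 \<le> k" "k \<le> m" for k
    using that
  proof (induction k rule: dec_induct)
    case base
    have "2 powr c \<le> 2 powr real k1"
      using k1 by (intro powr_mono) auto
    also have "\<dots> = 2 ^ k1"
      by (simp add: powr_realpow)
    also have "\<dots> \<le> 2 ^ (t * k1)"
      using n by (intro power_increasing) auto
    also have "\<dots> \<le> (2 * real r * c / real k1) ^ (t * k1)"
    proof (intro power_mono)
      have "2 * real k1 \<le> real r * (2 * c)"
        using r k1 c by (intro mult_mono) auto
      then show "2 \<le> 2 * real r * c / real k1"
        using k1 by (simp add: field_simps)
    qed auto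
    finally have "a k1 * 2 powr c \<le> a k1 * (2 * real r * c / real k1) ^ (t * k1)"
      using a0 by (intro mult_left_mono)
    also have "\<dots> \<le> 2 * \<beta> * (1 / 2) ^ k1"
      using base k1 by (intro main) auto
    finally show ?case .
  next
    case (step k)
    have "t * Suc k \<le> t * m"
      using step.prems by (intro mult_le_mono2)
    then have "t * Suc k \<le> n" "t * k \<le> n"
      using n by auto
    moreover have "real (2 * (m choose Suc k) * (n choose (t * k))) \<le> real ((m choose k) * (n choose (t * Suc k)))"
      unfolding of_nat_le_iff using step k1 n by (intro choose_ratio_halves) auto
    ultimately have "a (Suc k) \<le> a k / 2"
      unfolding a_def by (simp add: field_simps del: mult_Suc_right)
    then have "a (Suc k) * 2 powr c \<le> a k / 2 * 2 powr c"
      by (intro mult_right_mono) auto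
    also have "\<dots> = a k * 2 powr c / 2"
      by simp
    also have "\<dots> \<le> 2 * \<beta> * (1 / 2) ^ k / 2"
      using step by (intro divide_right_mono) auto
    finally show ?case
      by simp
  qed
  have "(\<Sum>k=1..m. a k * w k) \<le> (\<Sum>k=1..m. 2 * \<beta> * (1 / 2) ^ k)"
  proof (rule sum_mono)
    fix k assume k: "k \<in> {1..m}"
    show "a k * w k \<le> 2 * \<beta> * (1 / 2) ^ k"
    proof (cases "real k \<le> c")
      case True
      then have "a k * w k \<le> a k * (2 * real r * c / real k) ^ (t * k)"
        using k a0 w1 by (intro mult_left_mono) auto
      also have "\<dots> \<le> 2 * \<beta> * (1 / 2) ^ k"
        using k by (intro main) auto
      finally show ?thesis .
    next
      case False
      then have "k1 \<le> k"
        using c unfolding k1_def by linarith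
      have "a k * w k \<le> a k * 2 powr c"
        using a0 w2 by (intro mult_left_mono)
      also have "\<dots> \<le> 2 * \<beta> * (1 / 2) ^ k"
        using k \<open>k1 \<le> k\<close> by (intro tail) auto
      finally show ?thesis .
    qed
  qed
  also have "\<dots> = 2 * \<beta> * (1 - (1 / 2) ^ m)"
    by (induction m) (auto simp: algebra_simps)
  also have "\<dots> \<le> 2 * \<beta>"
    using \<beta>0 by (simp add: mult_left_le)
  finally show ?thesis
    by (simp add: a_def)
qed

section \<open>Second moment over the hypermatchings\<close>

text \<open>After exchanging the sums, a frequency S is charged only by those M that have its
  support as a union of hyperedges, and \<open>card_matched_times_choose_le\<close> bounds their
  number by the level of S alone.\<close>

lemma sum_tvd_image_dist_sq_le:
  assumes r: "0 < r" and t: "0 < t" and m: "real m = \<alpha> * real n / real t" "t * m \<le> n"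
    and A: "A \<subseteq> zvecs r n" "A \<noteq> {}"
  defines "A' \<equiv> {x \<in> {..<n} \<rightarrow>\<^sub>E {0..<int r}. vec n x \<in> A}"
  shows "(\<Sum>M\<in>hypermatchings \<alpha> t n.
      (tvd (zvecs r m) (image_dist r n A M) (pmf_of_set (zvecs r m)))\<^sup>2)
    \<le> real (card (hypermatchings \<alpha> t n)) * (\<Sum>k=1..m. real (m choose k) / real (n choose (t * k)) *
        ((\<Sum>S | S \<in> {..<n} \<rightarrow>\<^sub>E {0..<int r} \<and> card {i\<in>{..<n}. S i \<noteq> 0} = t * k.
          (cmod (dft r n (indicator A') S))\<^sup>2) / (real (card A))\<^sup>2))"
proof -
  define H where "H = hypermatchings \<alpha> t n"
  define P where "P k = {..<k} \<rightarrow>\<^sub>E {0..<int r}" for k :: nat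
  define supp where "supp S = {i\<in>{..<n}. S i \<noteq> 0}" for S :: "nat \<Rightarrow> int"
  define G where "G S = (cmod (dft r n (indicator A') S))\<^sup>2 / (real (card A))\<^sup>2" for S
  \<comment> \<open>The empty set is \<open>matched\<close> by every M, so the zero frequency has to
    be excluded explicitly.\<close>
  define hit where "hit M S \<longleftrightarrow> supp S \<noteq> {} \<and> matched M (supp S)" for M S
  have finP: "finite (P k)" for k by (auto simp: P_def intro!: finite_PiE)
  have finH: "finite H" by (simp add: H_def finite_hypermatchings)
  have len: "length M = m" if "M \<in> H" for M
    using that m by (simp add: H_def hypermatchings_def)
  have G0: "0 \<le> G S" for S by (simp add: G_def)
  have single: "(tvd (zvecs r m) (image_dist r n A M) (pmf_of_set (zvecs r m)))\<^sup>2
      \<le> (\<Sum>S\<in>P n. if hit M S then G S else 0)" if M: "M \<in> H" for M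
  proof -
    let ?z = "\<lambda>j\<in>{..<m}. 0 :: int"
    have M': "M \<in> hypermatchings \<alpha> t n" using M by (simp add: H_def)
    have "set_pmf (image_dist r n A M) \<subseteq> zvecs r m"
      using mult_mod_in_zvecs[OF r] len[OF M] by (auto simp: image_dist_def)
    then have "(tvd (zvecs r m) (image_dist r n A M) (pmf_of_set (zvecs r m)))\<^sup>2
        \<le> (\<Sum>V\<in>P m - {?z}. (cmod (dft r m (\<lambda>z. pmf (image_dist r n A M) (vec m z)) V))\<^sup>2)"
      unfolding P_def by (intro tvd_uniform_sq_le r)
    also have "\<dots> = (\<Sum>V\<in>P m - {?z}. G (spread n M V))"
      using dft_image_dist[OF r A, of M, unfolded len[OF M]]
      by (simp add: G_def A'_def norm_divide power_divide)
    also have "\<dots> = (\<Sum>S\<in>spread n M ` (P m - {?z}). G S)"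
      using inj_on_spread[OF M' t, of "{0..<int r}", unfolded len[OF M]]
      by (subst sum.reindex) (auto simp: P_def intro: inj_on_subset)
    also have "\<dots> \<le> (\<Sum>S\<in>{S \<in> P n. hit M S}. G S)"
    proof (intro sum_mono2)
      show "spread n M ` (P m - {?z}) \<subseteq> {S \<in> P n. hit M S}"
      proof (intro image_subsetI)
        fix V assume V: "V \<in> P m - {?z}"
        have "spread n M V \<in> P n"
          using V spread_in_PiE[OF M' r] len[OF M] by (simp add: P_def)
        moreover have "matched M (supp (spread n M V))"
          unfolding matched_def supp_def support_spread[OF M']
          by (intro exI[of _ "{j \<in> {..<length M}. V j \<noteq> 0}"] conjI refl) auto
        moreover have "supp (spread n M V) \<noteq> {}"
        proof -
          have "?z \<in> P m" using r by (auto simp: P_def)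
          then obtain j where j: "j < m" "V j \<noteq> 0"
            using V PiE_ext[of V "{..<m}" _ ?z] unfolding P_def by (metis DiffE lessThan_iff restrict_apply' singletonI)
          moreover have "card (M ! j) = t"
            using M j len[OF M] by (auto simp: H_def hypermatchings_def simp del: in_set_conv_nth)
          then have "M ! j \<noteq> {}" using t by auto
          ultimately show ?thesis
            unfolding supp_def support_spread[OF M'] len[OF M] by auto
        qed
        ultimately show "spread n M V \<in> {S \<in> P n. hit M S}"
          by (simp add: hit_def)
      qed
    qed (use finP G0 in auto)
    also have "\<dots> = (\<Sum>S\<in>P n. if hit M S then G S else 0)"
      using finP by (rule sum.inter_filter)
    finally show ?thesis .
  qed
  have "(\<Sum>M\<in>H. (tvd (zvecs r m) (image_dist r n A M) (pmf_of_set (zvecs r m)))\<^sup>2)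
      \<le> (\<Sum>M\<in>H. \<Sum>S\<in>P n. if hit M S then G S else 0)"
    by (intro sum_mono single)
  \<comment> \<open>Sorting by level: the support of a hit frequency is a union of |J| hyperedges
    with J nonempty, so its size is t k for k = |J| between 1 and m.\<close>
  also have "\<dots> \<le> (\<Sum>M\<in>H. \<Sum>S\<in>P n. \<Sum>k=1..m. if card (supp S) = t * k then (if hit M S then G S else 0) else 0)"
  proof (intro sum_mono)
    fix M S assume M: "M \<in> H"
    show "(if hit M S then G S else 0)
      \<le> (\<Sum>k=1..m. if card (supp S) = t * k then (if hit M S then G S else 0) else 0)"
    proof (cases "hit M S")
      case True
      then obtain J where J: "J \<subseteq> {..<m}" "supp S = (\<Union>j\<in>J. M ! j)" "J \<noteq> {}"
        using len[OF M] by (auto simp: hit_def matched_def)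
      then have card: "card (supp S) = t * card J"
        using card_UN_hyperedges[of M \<alpha> t n J] M len[OF M] by (simp add: H_def)
      have "card J \<le> m"
        using card_mono[OF _ J(1)] by simp
      moreover have "finite J"
        using J(1) finite_subset by blast
      then have "1 \<le> card J"
        using J(3) by (simp add: Suc_le_eq card_gt_0_iff)
      ultimately have "card J \<in> {1..m}" by simp
      then show ?thesis
        using member_le_sum[of "card J" "{1..m}"
            "\<lambda>k. if card (supp S) = t * k then (if hit M S then G S else 0) else 0"] card G0 by simp
    qed simp
  qed
  also have "\<dots> = (\<Sum>k=1..m. \<Sum>S\<in>P n. \<Sum>M\<in>H. if card (supp S) = t * k then (if hit M S then G S else 0) else 0)"
    \<comment> \<open>Brings k outermost and M innermost, so that the M hitting a fixed S can be
      counted.\<close>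
    by (subst sum.swap, subst (2) sum.swap, subst sum.swap) (rule refl)
  also have "\<dots> \<le> (\<Sum>k=1..m. \<Sum>S\<in>P n. if card (supp S) = t * k
      then real (card H) * (real (m choose k) / real (n choose (t * k))) * G S else 0)"
  proof (intro sum_mono)
    fix k S assume k: "k \<in> {1..m}"
    show "(\<Sum>M\<in>H. if card (supp S) = t * k then (if hit M S then G S else 0) else 0) \<le>
      (if card (supp S) = t * k then real (card H) * (real (m choose k) / real (n choose (t * k))) * G S else 0)"
    proof (cases "card (supp S) = t * k")
      case True
      have "t * k \<le> n"
        using k m(2) le_trans[of "t * k" "t * m" n] by simp
      then have pos: "0 < real (n choose (t * k))" by simp
      have "(\<Sum>M\<in>H. if hit M S then G S else 0) \<le> (\<Sum>M\<in>H. if matched M (supp S) then G S else 0)"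
        using G0 by (intro sum_mono) (auto simp: hit_def)
      also have "\<dots> = real (card {M \<in> H. matched M (supp S)}) * G S"
        using finH by (simp flip: sum.inter_filter)
      also have "\<dots> \<le> real (card H) * (real (m choose k) / real (n choose (t * k))) * G S"
      proof (intro mult_right_mono G0)
        have "real (card {M \<in> H. matched M (supp S)} * (n choose (t * k))) \<le> real (card H * (m choose k))"
          unfolding of_nat_le_iff H_def
          by (rule card_matched_times_choose_le[OF _ True t m(1)]) (auto simp: supp_def)
        then show "real (card {M \<in> H. matched M (supp S)})
            \<le> real (card H) * (real (m choose k) / real (n choose (t * k)))"
          using pos by (simp add: field_simps)
      qed
      finally show ?thesis using True by simp
    qed simp
  qed
  also have "\<dots> = real (card H) * (\<Sum>k=1..m. real (m choose k) / real (n choose (t * k)) *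
      (\<Sum>S | S \<in> P n \<and> card (supp S) = t * k. G S))"
    by (simp add: sum.inter_filter[OF finP] sum_distrib_left mult.assoc if_distrib cong: if_cong)
  finally show ?thesis
    by (simp add: G_def H_def P_def supp_def sum_divide_distrib)
qed

section \<open>Choice of the constant and conclusion\<close>

lemma tvd_le_2:
  assumes "finite S"
  shows "tvd S P Q \<le> 2"
proof -
  have le1: "(\<Sum>z\<in>S. pmf p z) \<le> 1" for p :: "'a pmf"
    using assms measure_pmf.prob_le_1[of p S] by (simp add: measure_measure_pmf_finite)
  have "tvd S P Q \<le> (\<Sum>z\<in>S. pmf P z + pmf Q z)"
    unfolding tvd_def by (intro sum_mono) (simp add: abs_le_iff add_increasing add_increasing2)
  also have "\<dots> \<le> 1 + 1"
    unfolding sum.distrib by (intro add_mono le1)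
  finally show ?thesis by simp
qed

lemma expected_tvd_le:
  fixes c \<epsilon> \<alpha> :: real
  assumes r: "2 \<le> r" and t: "2 \<le> t" and \<alpha>: "0 < \<alpha>" "\<alpha> \<le> 1 / 2" and m: "\<alpha> * real n / real t = real m"
    and c: "1 \<le> c" and A: "A \<subseteq> zvecs r n" "real r ^ n / 2 powr c \<le> real (card A)"
    and \<epsilon>: "0 < \<epsilon>"
    and small: "c \<le> 1 / 8 / real r * (\<epsilon> ^ 4 / \<alpha>) powr (1 / real t) * (real n / real t) powr (1 - 1 / real t)"
  shows "measure_pmf.expectation (pmf_of_set (hypermatchings \<alpha> t n))
      (\<lambda>M. tvd (zvecs r m) (image_dist r n A M) (pmf_of_set (zvecs r m))) \<le> \<epsilon> ^ 2"
proof -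
  define H where "H = hypermatchings \<alpha> t n"
  define f where "f M = tvd (zvecs r m) (image_dist r n A M) (pmf_of_set (zvecs r m))" for M
  have finH: "finite H" by (simp add: H_def finite_hypermatchings)
  have neH: "H \<noteq> {}" unfolding H_def using \<alpha> t m by (intro hypermatchings_nonempty) auto
  have cardH: "0 < real (card H)" using finH neH by (simp add: card_gt_0_iff)
  have E: "measure_pmf.expectation (pmf_of_set H) f = (\<Sum>M\<in>H. f M) / real (card H)"
    by (rule integral_pmf_of_set[OF neH finH])
  have "(\<Sum>M\<in>H. f M) / real (card H) \<le> \<epsilon> ^ 2"
  \<comment> \<open>A large \<epsilon> is covered by \<open>tvd_le_2\<close>. Otherwise \<epsilon>^4
    <= 4, which puts \<beta> = \<epsilon>^4 / 16 below the 1/2 that the geometric series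
    demands.\<close>
  proof (cases "2 \<le> \<epsilon> ^ 2")
    case True
    have "(\<Sum>M\<in>H. f M) \<le> (\<Sum>M\<in>H. 2)"
      unfolding f_def by (intro sum_mono tvd_le_2 finite_zvecs)
    then have "(\<Sum>M\<in>H. f M) / real (card H) \<le> 2"
      using cardH by (simp add: field_simps)
    with True show ?thesis by linarith
  next
    case False
    then have "(\<epsilon> ^ 2) ^ 2 \<le> 2 ^ 2"
      by (intro power_mono) auto
    then have \<epsilon>4: "\<epsilon> ^ 4 \<le> 4"
      by (simp flip: power_mult)
    \<comment> \<open>For n = 0 the hypothesis \<open>small\<close> would read c <= 0, since
      \<open>0 powr x\<close> is 0.\<close>
    have n0: "0 < real n"
      using small c by (cases "n = 0") auto
    have tm: "real t * real m = \<alpha> * real n"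
      using m t by (simp add: field_simps)
    also have "\<dots> \<le> 1 / 2 * real n"
      using \<alpha> by (intro mult_right_mono) auto
    finally have "real (2 * t * m) \<le> real n"
      by simp
    then have n2: "2 * t * m \<le> n"
      by (simp only: of_nat_le_iff)
    define \<beta> where "\<beta> = \<epsilon> ^ 4 / 16"
    have \<beta>: "real m * (2 * real r * c * real t / real n) ^ t \<le> \<beta>"
    proof -
      \<comment> \<open>The constant 1/8 becomes 1/4 here, and t >= 2 makes its t-th power at most
        1/16.\<close>
      have "2 * real r * c \<le> 1 / 4 * ((\<epsilon> ^ 4 / \<alpha>) powr (1 / real t) * (real n / real t) powr (1 - 1 / real t))"
        using mult_left_mono[OF small, of "2 * real r"] r by (simp add: mult_ac)
      then have "(2 * real r * c) ^ t \<le>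
          (1 / 4 * ((\<epsilon> ^ 4 / \<alpha>) powr (1 / real t) * (real n / real t) powr (1 - 1 / real t))) ^ t"
        using c by (intro power_mono) auto
      also have "\<dots> = (1 / 4) ^ t * (\<epsilon> ^ 4 / \<alpha> * (real n / real t) powr (real t - 1))"
      proof -
        have "((\<epsilon> ^ 4 / \<alpha>) powr (1 / real t)) ^ t = \<epsilon> ^ 4 / \<alpha>"
          using \<epsilon> \<alpha> t by (simp add: powr_power)
        moreover have "((real n / real t) powr (1 - 1 / real t)) ^ t = (real n / real t) powr (real t - 1)"
          using n0 t by (simp add: powr_power algebra_simps)
        ultimately show ?thesis by (simp only: power_mult_distrib)
      qed
      also have "(real n / real t) powr (real t - 1) = (real n / real t) ^ t * (real t / real n)"
        using n0 t by (simp add: powr_diff powr_realpow)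
      finally have *: "(2 * real r * c) ^ t \<le>
          (1 / 4) ^ t * (\<epsilon> ^ 4 / \<alpha> * ((real n / real t) ^ t * (real t / real n)))" .
      have "real m * (2 * real r * c * real t / real n) ^ t =
          real m * (real t / real n) ^ t * (2 * real r * c) ^ t"
        by (simp add: power_mult_distrib power_divide)
      also have "\<dots> \<le> real m * (real t / real n) ^ t *
          ((1 / 4) ^ t * (\<epsilon> ^ 4 / \<alpha> * ((real n / real t) ^ t * (real t / real n))))"
        using * by (intro mult_left_mono) auto
      also have "\<dots> = (1 / 4) ^ t * (\<epsilon> ^ 4 / \<alpha>) * (real m * (real t / real n)) *
          ((real t / real n) * (real n / real t)) ^ t"
        by (simp only: power_mult_distrib mult_ac)
      also have "(real t / real n) * (real n / real t) = 1"
        using n0 t by simp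
      \<comment> \<open>The edge density \<alpha> cancels the denominator of \<epsilon>^4 /
        \<alpha>.\<close>
      also have "real m * (real t / real n) = \<alpha>"
        using tm n0 by (simp add: field_simps)
      also have "(1 / 4) ^ t * (\<epsilon> ^ 4 / \<alpha>) * \<alpha> * 1 ^ t = (1 / 4) ^ t * \<epsilon> ^ 4"
        using \<alpha> by simp
      also have "\<dots> \<le> (1 / 4) ^ 2 * \<epsilon> ^ 4"
        using t \<epsilon> by (intro mult_right_mono power_decreasing) auto
      finally show ?thesis
        by (simp add: \<beta>_def power2_eq_square)
    qed
    define A' where "A' = {x \<in> {..<n} \<rightarrow>\<^sub>E {0..<int r}. vec n x \<in> A}"
    have A'sub: "A' \<subseteq> {..<n} \<rightarrow>\<^sub>E {0..<int r}" by (auto simp: A'_def)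
    have "A \<subseteq> vec n ` ({..<n} \<rightarrow>\<^sub>E {0..<int r})"
      using A(1) by (simp only: bij_betw_imp_surj_on[OF bij_betw_zvecs])
    then have "vec n ` A' = A"
      by (auto simp: A'_def)
    then have "bij_betw (vec n) A' A"
      by (rule bij_betw_subset[OF bij_betw_zvecs A'sub])
    then have cardA': "card A' = card A"
      by (rule bij_betw_same_card)
    have "0 < real r ^ n / 2 powr c" using r by simp
    with A(2) have A0: "0 < real (card A)" by linarith
    then have neA: "A \<noteq> {}" by auto
    define W where "W k = (\<Sum>S | S \<in> {..<n} \<rightarrow>\<^sub>E {0..<int r} \<and> card {i\<in>{..<n}. S i \<noteq> 0} = t * k.
          (cmod (dft r n (indicator A') S))\<^sup>2) / (real (card A))\<^sup>2" for k
    have "(\<Sum>M\<in>H. (f M)\<^sup>2) \<le> real (card H) * (\<Sum>k=1..m. real (m choose k) / real (n choose (t * k)) * W k)"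
      unfolding H_def f_def W_def A'_def
      using r t m n2 A(1) neA by (intro sum_tvd_image_dist_sq_le) auto
    also have "\<dots> \<le> real (card H) * (2 * \<beta>)"
    proof (intro mult_left_mono weighted_choose_ratio_sum_le[OF n2 _ r c \<beta>])
      show "\<beta> \<le> 1 / 2" using \<epsilon>4 by (simp add: \<beta>_def)
      show "W k \<le> (2 * real r * c / real k) ^ (t * k)" if "1 \<le> k" "real k \<le> c" for k
        unfolding W_def
        using level_inequality[OF A'sub r, of c k "t * k"] A(2) that t A0 by (simp add: cardA' divide_le_eq)
      show "W k \<le> 2 powr c" for k
        unfolding W_def
        using sum_dft_indicator_le[OF A'sub _, of c "{S. S \<in> {..<n} \<rightarrow>\<^sub>E {0..<int r} \<and> card {i\<in>{..<n}. S i \<noteq> 0} = t * k}"]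
          A(2) A0 r by (simp add: cardA' divide_le_eq subset_eq)
    qed (use t in auto)
    also have "\<dots> \<le> real (card H) * \<epsilon> ^ 4"
      by (intro mult_left_mono) (auto simp: \<beta>_def)
    finally have sq: "(\<Sum>M\<in>H. (f M)\<^sup>2) \<le> real (card H) * \<epsilon> ^ 4" .
    \<comment> \<open>Cauchy-Schwarz over M passes from the second moment \<epsilon>^4 to the mean
      \<epsilon>^2.\<close>
    have "(\<Sum>M\<in>H. f M)\<^sup>2 \<le> (\<Sum>M\<in>H. (f M)\<^sup>2) * real (card H)"
      by (rule sum_squared_le_sum_of_squares)
    also have "\<dots> \<le> (real (card H) * \<epsilon> ^ 4) * real (card H)"
      using sq by (intro mult_right_mono) auto
    also have "\<dots> = (real (card H) * \<epsilon> ^ 2) ^ 2"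
      by (simp add: power2_eq_square power4_eq_xxxx mult_ac)
    finally have "(\<Sum>M\<in>H. f M) \<le> real (card H) * \<epsilon> ^ 2"
      by (rule power2_le_imp_le) simp
    then show ?thesis
      using cardH by (simp add: field_simps)
  qed
  then show ?thesis
    unfolding H_def[symmetric] f_def[symmetric] E .
qed

theorem theoremA4:
  shows "\<exists>\<gamma>::real. \<gamma> > 0 \<and>
    (\<forall>(r::nat) (t::nat) (n::nat) (m::nat) (\<alpha>::real) (c::real) (A::int vec set) (\<epsilon>::real).
       r \<ge> 2 \<longrightarrow> t \<ge> 2 \<longrightarrow> t dvd n \<longrightarrow> 0 < \<alpha> \<longrightarrow> \<alpha> \<le> 1 / 2 \<longrightarrow>
       \<alpha> * real n / real t = real m \<longrightarrow>
       c \<ge> 1 \<longrightarrow> A \<subseteq> zvecs r n \<longrightarrow> real (card A) \<ge> real r ^ n / 2 powr c \<longrightarrow>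
       \<epsilon> > 0 \<longrightarrow>
       c \<le> \<gamma> / real r * (\<epsilon> ^ 4 / \<alpha>) powr (1 / real t)
             * (real n / real t) powr (1 - 1 / real t) \<longrightarrow>
       measure_pmf.expectation (pmf_of_set (hypermatchings \<alpha> t n))
         (\<lambda>M. tvd (zvecs r m) (image_dist r n A M) (pmf_of_set (zvecs r m)))
       \<le> \<epsilon> ^ 2)"
  by (rule exI[of _ "1 / 8"]) (intro conjI allI impI expected_tvd_le; simp)

end
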